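(* Let $\mathbb F_q$ be a finite field of characteristic at least five, and let $\sigma\in\mathbb F_q$ be a nonsquare. Then any cubic rational expression $R(x)$ over $\mathbb F_q$ with at most three ramification points in $\mathbb P^1(\overline{\mathbb F}_q)$ is equivalent over $\mathbb F_q$ to one of $x^3$, $(x^3+3\sigma x)/(3x^2+\sigma)$, $x^3-3x$, or $x^3-3\sigma x$.
   Context: A rational expression $R(x)=g(x)/h(x)$ with $g,h$ coprime has degree $\max(\deg g,\deg h)$; cubic means degree $3$. The group $G(\mathbb F_q)=\mathrm{PGL}_2(\mathbb F_q)\times\mathrm{PGL}_2(\mathbb F_q)$, with $\mathrm{PGL}_2(\mathbb F_q)$ identified with the group of degree-one rational expressions (Möbius transformations) over $\mathbb F_q$ under composition, acts on $\mathbb F_q(x)$ by $(B,A)\cdot R(x)=B(R(A^{-1}(x)))$; two expressions are equivalent over $\mathbb F_q$ if they lie in the same $G(\mathbb F_q)$-orbit. Viewing $R$ as a map $\mathbb P^1(\overline{\mathbb F}_q)\to\mathbb P^1(\overline{\mathbb F}_q)$, a ramification point is a point $P$ whose ramification index $e_R(P)$ (multiplicity of $P$ in the fibre $R^{-1}(R(P))$) exceeds $1$. *)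

theory Defs
  imports
    "HOL-Algebra.Algebraic_Closure_Type"
    "HOL-Algebra.Group_Action"
begin

text \<open>The field \<open>F(x)\<close> of rational expressions is \<open>'a poly fract\<close>, for a field \<open>'a\<close>.\<close>

definition is_lowest_terms ::
    "'a::field poly fract \<Rightarrow> 'a poly \<Rightarrow> 'a poly \<Rightarrow> bool" where
  "is_lowest_terms R g h \<longleftrightarrow> h \<noteq> 0 \<and> coprime g h \<and> R = Fraction_Field.Fract g h"

text \<open>
  A representation in lowest terms is unique up to a common constant factor,
  and nothing below depends on the choice. The library's \<open>quot_of_fract\<close> is not used
  because it would require gcd operations on the coefficient field.
\<close>

definition lowest_terms :: "'a::field poly fract \<Rightarrow> 'a poly \<times> 'a poly" where
  "lowest_terms R = (SOME (g, h). is_lowest_terms R g h)"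

definition rat_num :: "'a::field poly fract \<Rightarrow> 'a poly" where
  "rat_num R = fst (lowest_terms R)"

definition rat_den :: "'a::field poly fract \<Rightarrow> 'a poly" where
  "rat_den R = snd (lowest_terms R)"

lemma is_lowest_terms_exists: "\<exists>g h. is_lowest_terms R g h"
proof -
  define P where
    "P = (\<lambda>n. \<exists>g h. h \<noteq> 0 \<and> R = Fraction_Field.Fract g h \<and> Polynomial.degree h = n)"
  have "\<exists>n. P n"
    unfolding P_def by (cases R) auto
  then have "P (LEAST n. P n)"
    by (rule LeastI_ex)
  then obtain g h where gh: "h \<noteq> 0" "R = Fraction_Field.Fract g h"
      "Polynomial.degree h = (LEAST n. P n)"
    unfolding P_def by blast
  have "coprime g h"
  proof (rule coprimeI)
    fix c assume "c dvd g" "c dvd h"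
    then obtain g' h' where c: "g = c * g'" "h = c * h'" by (auto elim!: dvdE)
    with gh have nz: "c \<noteq> 0" "h' \<noteq> 0" by auto
    have "R = Fraction_Field.Fract g' h'"
      using gh nz c by (simp add: eq_fract)
    with nz have "P (Polynomial.degree h')"
      unfolding P_def by blast
    then have "Polynomial.degree h \<le> Polynomial.degree h'"
      using gh by (simp add: Least_le)
    then have "Polynomial.degree c = 0"
      using c nz by (simp add: degree_mult_eq)
    with nz show "is_unit c" by (simp add: is_unit_iff_degree)
  qed
  with gh show ?thesis unfolding is_lowest_terms_def by blast
qed

lemma is_lowest_terms_num_den: "is_lowest_terms R (rat_num R) (rat_den R)"
proof -
  have "\<exists>p. case p of (g, h) \<Rightarrow> is_lowest_terms R g h"
    using is_lowest_terms_exists[of R] by auto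
  then have "case lowest_terms R of (g, h) \<Rightarrow> is_lowest_terms R g h"
    unfolding lowest_terms_def by (rule someI_ex)
  then show ?thesis
    by (simp add: rat_num_def rat_den_def case_prod_beta)
qed

definition rat_degree :: "'a::field poly fract \<Rightarrow> nat" where
  "rat_degree R = max (Polynomial.degree (rat_num R)) (Polynomial.degree (rat_den R))"

definition rat_const :: "'a::field \<Rightarrow> 'a poly fract" where
  "rat_const c = to_fract [:c:]"

definition rat_X :: "'a::field poly fract" where
  "rat_X = to_fract [:0, 1:]"

text \<open>
  Composition \<open>R(S(x))\<close>. For constant \<open>S\<close> the denominator may vanish, and the
  value is then a junk value; only nonconstant \<open>S\<close> matter for expressions of positive degree.
\<close>

definition rat_comp ::
    "'a::field poly fract \<Rightarrow> 'a poly fract \<Rightarrow> 'a poly fract" where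
  "rat_comp R S =
     poly (map_poly rat_const (rat_num R)) S / poly (map_poly rat_const (rat_den R)) S"

definition PGL2 :: "'a::field poly fract monoid" where
  "PGL2 = \<lparr>carrier = {A. rat_degree A = 1}, monoid.mult = rat_comp, one = rat_X\<rparr>"

definition mobius_act ::
    "'a::field poly fract \<times> 'a poly fract \<Rightarrow> 'a poly fract \<Rightarrow> 'a poly fract" where
  "mobius_act = (\<lambda>(B, A) R. rat_comp B (rat_comp R (inv\<^bsub>PGL2\<^esub> A)))"

definition rat_equivalent :: "'a::field poly fract \<Rightarrow> 'a poly fract \<Rightarrow> bool" where
  "rat_equivalent R S \<longleftrightarrow> S \<in> orbit (PGL2 \<times>\<times> PGL2) mobius_act R"

datatype 'a proj_line = Finite 'a | Infinity

definition ac_num :: "'a::field poly fract \<Rightarrow> 'a alg_closure poly" where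
  "ac_num R = map_poly to_ac (rat_num R)"

definition ac_den :: "'a::field poly fract \<Rightarrow> 'a alg_closure poly" where
  "ac_den R = map_poly to_ac (rat_den R)"

text \<open>
  At infinity, with \<open>d = rat_degree R\<close>, the map takes the value
  \<open>[coeff g d : coeff h d]\<close> in homogeneous coordinates.
\<close>

fun rat_map ::
    "'a::field poly fract \<Rightarrow> 'a alg_closure proj_line \<Rightarrow> 'a alg_closure proj_line" where
  "rat_map R (Finite a) =
     (if poly (ac_den R) a = 0 then Infinity
      else Finite (poly (ac_num R) a / poly (ac_den R) a))"
| "rat_map R Infinity =
     (if Polynomial.coeff (ac_den R) (rat_degree R) = 0 then Infinity
      else Finite (Polynomial.coeff (ac_num R) (rat_degree R) /
                   Polynomial.coeff (ac_den R) (rat_degree R)))"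

text \<open>
  The fibre over \<open>Q\<close> is the zero divisor of a binary form of degree \<open>rat_degree R\<close>,
  given here by its dehomogenization: \<open>g - b h\<close> over a finite \<open>b\<close>, and \<open>h\<close> over infinity.
  Its multiplicity at infinity is the amount by which the degree drops.
\<close>

fun fibre_poly ::
    "'a::field poly fract \<Rightarrow> 'a alg_closure proj_line \<Rightarrow> 'a alg_closure poly" where
  "fibre_poly R (Finite b) = ac_num R - Polynomial.smult b (ac_den R)"
| "fibre_poly R Infinity = ac_den R"

fun fibre_mult ::
    "'a::field poly fract \<Rightarrow> 'a alg_closure proj_line \<Rightarrow> 'a alg_closure proj_line \<Rightarrow> nat" where
  "fibre_mult R Q (Finite a) = Polynomial.order a (fibre_poly R Q)"
| "fibre_mult R Q Infinity = rat_degree R - Polynomial.degree (fibre_poly R Q)"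

definition ram_index :: "'a::field poly fract \<Rightarrow> 'a alg_closure proj_line \<Rightarrow> nat" where
  "ram_index R P = fibre_mult R (rat_map R P) P"

definition ramification_points :: "'a::field poly fract \<Rightarrow> 'a alg_closure proj_line set" where
  "ramification_points R = {P. ram_index R P > 1}"

end

theory Submission
  imports Defs
begin

text \<open>
  Write \<open>R = g/h\<close> in lowest terms. The ramification points are the zeros of the Wronskian
  \<open>W = g' h - g h'\<close>, a binary form of degree four over the ground field \<open>F\<close>, so with at most
  three of them \<open>W\<close> has a double zero \<open>\<alpha>\<close>. If \<open>p\<close> is the minimal polynomial of
  \<open>\<alpha>\<close> over \<open>F\<close>, then \<open>p\<^sup>2\<close> divides \<open>W\<close>, as \<open>p\<close> is separable; hence
  \<open>p\<close> has degree at most two. A rational \<open>\<alpha>\<close> can be moved to infinity, and then some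
  \<open>F\<close>-combination of \<open>g\<close> and \<open>h\<close> is constant: \<open>R\<close> is equivalent to a cubic
  polynomial, which is brought to the form \<open>x\<^sup>3 + e x\<close> and rescaled. A quadratic \<open>p\<close> can be
  moved to \<open>x\<^sup>2 - \<sigma>\<close>, because the ratio of two nonsquares is a square; then
  \<open>W = k (x\<^sup>2 - \<sigma>)\<^sup>2\<close> determines the span of the
  coprime polynomials \<open>g\<close> and \<open>h\<close>.
\<close>

subsection \<open>Field embeddings and substitution\<close>

text \<open>A nonzero combination of \<open>g\<close> and \<open>h\<close> of least degree divides
  all combinations, by division with remainder; coprimality makes it a unit.\<close>

lemma poly_bezout:
  fixes g h :: "'a::field poly"
  assumes "coprime g h"
  obtains a b where "a * g + b * h = 1"
proof -
  define P where "P = (\<lambda>p. p \<noteq> 0 \<and> (\<exists>a b. p = a * g + b * h))"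
  have "g \<noteq> 0 \<or> h \<noteq> 0"
    using assms by auto
  moreover have "g = 1 * g + 0 * h" "h = 0 * g + 1 * h" by auto
  ultimately have "\<exists>p. P p"
    unfolding P_def by metis
  then obtain p where p: "P p" and least: "\<And>r. P r \<Longrightarrow> Polynomial.degree p \<le> Polynomial.degree r"
    using ex_has_least_nat[of P _ Polynomial.degree] by blast
  then obtain a b where ab: "p = a * g + b * h" by (auto simp: P_def)
  have dvd: "p dvd u * g + v * h" for u v
  proof -
    define r where "r = (u * g + v * h) mod p"
    have "r = u * g + v * h - (u * g + v * h) div p * p"
      unfolding r_def by (simp add: minus_div_mult_eq_mod)
    also have "\<dots> = (u - (u * g + v * h) div p * a) * g + (v - (u * g + v * h) div p * b) * h"
      unfolding ab by (simp add: algebra_simps)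
    finally have "r \<noteq> 0 \<Longrightarrow> P r" unfolding P_def by blast
    moreover have "r = 0 \<or> Polynomial.degree r < Polynomial.degree p"
      using p degree_mod_less[of p "u * g + v * h"] by (simp add: P_def r_def)
    ultimately have "r = 0" using least[of r] by linarith
    then show ?thesis by (auto simp: r_def)
  qed
  from dvd[of 1 0] dvd[of 0 1] have "is_unit p"
    using assms by (auto intro: coprime_common_divisor)
  then obtain q where "1 = p * q" by (auto elim: dvdE)
  then have "(q * a) * g + (q * b) * h = 1"
    by (simp add: ab algebra_simps)
  then show thesis by (rule that)
qed

lemma coprime_poly_dvd_mult:
  fixes g h :: "'a::field poly"
  assumes "coprime g h" "h dvd g * q"
  shows "h dvd q"
proof -
  obtain a b where "a * g + b * h = 1"
    using assms(1) by (rule poly_bezout)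
  then have "q = (a * g + b * h) * q" by simp
  also have "\<dots> = a * (g * q) + b * q * h" by (simp add: algebra_simps)
  finally show ?thesis
    using assms(2) by (metis dvd_add dvd_mult dvd_triv_right)
qed

text \<open>Three embeddings are treated uniformly: \<open>to_ac\<close> into the algebraic closure,
  \<open>rat_const\<close> into the rational expressions, and substitution of a transcendental
  \<open>S\<close>.\<close>

locale field_embedding =
  fixes f :: "'a::field \<Rightarrow> 'b::field"
  assumes zero [simp]: "f 0 = 0" and one [simp]: "f 1 = 1"
    and add [simp]: "f (x + y) = f x + f y"
    and mult [simp]: "f (x * y) = f x * f y"
begin

lemma eq_0_iff [simp]: "f x = 0 \<longleftrightarrow> x = 0"
  by (metis mult one zero right_inverse mult_zero_left zero_neq_one)

lemma uminus [simp]: "f (- x) = - f x"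
  by (metis add add.right_inverse add_eq_0_iff zero)

lemma diff [simp]: "f (x - y) = f x - f y"
  using add[of x "- y"] by simp

lemma inverse [simp]: "f (inverse x) = inverse (f x)"
  by (metis eq_0_iff inverse_unique inverse_zero mult one right_inverse)

lemma divide [simp]: "f (x / y) = f x / f y"
  by (simp add: divide_inverse)

lemma power [simp]: "f (x ^ n) = f x ^ n"
  by (induction n) auto

lemma of_nat [simp]: "f (of_nat n) = of_nat n"
  by (induction n) auto

lemma numeral [simp]: "f (numeral n) = numeral n"
  using of_nat[of "numeral n"] by (simp del: of_nat)

lemma map_poly_pCons [simp]: "map_poly f (pCons a p) = pCons (f a) (map_poly f p)"
  by (simp add: Polynomial.map_poly_pCons)

lemma coeff_map_poly [simp]: "Polynomial.coeff (map_poly f p) n = f (Polynomial.coeff p n)"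
  by (simp add: Polynomial.coeff_map_poly)

lemma map_poly_add [simp]: "map_poly f (p + q) = map_poly f p + map_poly f q"
  by (rule poly_eqI) simp

lemma map_poly_diff [simp]: "map_poly f (p - q) = map_poly f p - map_poly f q"
  by (rule poly_eqI) simp

lemma map_poly_smult [simp]:
  "map_poly f (Polynomial.smult c p) = Polynomial.smult (f c) (map_poly f p)"
  by (rule poly_eqI) simp

lemma map_poly_mult [simp]: "map_poly f (p * q) = map_poly f p * map_poly f q"
  by (induction p) (auto simp: mult_pCons_left)

lemma map_poly_pderiv: "map_poly f (pderiv p) = pderiv (map_poly f p)"
  by (rule poly_eqI) (simp add: coeff_pderiv)

lemma degree_map_poly [simp]: "Polynomial.degree (map_poly f p) = Polynomial.degree p"
  by (rule Polynomial.degree_map_poly) simp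

lemma map_poly_eq_0_iff [simp]: "map_poly f p = 0 \<longleftrightarrow> p = 0"
  by (rule Polynomial.map_poly_eq_0_iff) auto

text \<open>A nonzero polynomial of least degree vanishing at \<alpha> works: the remainder of any
  other such polynomial also vanishes there, so it is zero. No monic normalization is
  imposed.\<close>

lemma ex_minimal_poly:
  assumes "q \<noteq> 0" "poly (map_poly f q) \<alpha> = 0"
  obtains p where "p \<noteq> 0" "\<And>r. poly (map_poly f r) \<alpha> = 0 \<longleftrightarrow> p dvd r"
proof -
  define P where "P = (\<lambda>p. p \<noteq> 0 \<and> poly (map_poly f p) \<alpha> = 0)"
  obtain p where p: "P p" and least: "\<And>r. P r \<Longrightarrow> Polynomial.degree p \<le> Polynomial.degree r"
    using ex_has_least_nat[of P q Polynomial.degree] assms unfolding P_def by blast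
  have "p dvd r" if r: "poly (map_poly f r) \<alpha> = 0" for r
  proof -
    have "map_poly f r = map_poly f (p * (r div p) + r mod p)" by simp
    then have "map_poly f r = map_poly f p * map_poly f (r div p) + map_poly f (r mod p)"
      by (metis map_poly_add map_poly_mult)
    then have "poly (map_poly f (r mod p)) \<alpha> = 0"
      using r p by (simp add: P_def)
    moreover have "r mod p = 0 \<or> Polynomial.degree (r mod p) < Polynomial.degree p"
      using p degree_mod_less[of p r] by (simp add: P_def)
    ultimately have "r mod p = 0"
      using least[of "r mod p"] unfolding P_def by (meson leD)
    then show ?thesis by auto
  qed
  moreover have "poly (map_poly f r) \<alpha> = 0" if "p dvd r" for r
    using that p by (auto simp: P_def elim!: dvdE)
  ultimately show thesis
    using that[of p] p unfolding P_def by blast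
qed

end

interpretation to_ac: field_embedding to_ac
  by standard auto

interpretation rat_const: field_embedding rat_const
proof
  show "rat_const 1 = 1"
    by (metis one_pCons rat_const_def to_fract_1)
qed (auto simp: rat_const_def simp flip: to_fract_add to_fract_mult)

lemma to_fract_pCons: "to_fract (pCons a p) = rat_const a + rat_X * to_fract p"
  by (simp add: rat_const_def rat_X_def flip: to_fract_add to_fract_mult)

lemma to_fract_smult: "to_fract (Polynomial.smult c p) = rat_const c * to_fract p"
  by (simp add: rat_const_def flip: to_fract_mult)

lemma poly_rat_X: "poly (map_poly rat_const p) rat_X = to_fract p"
  by (induction p) (simp_all add: to_fract_pCons)

lemma poly_to_fract: "poly (map_poly rat_const p) (to_fract k) = to_fract (pcompose p k)"
  by (induction p) (simp_all add: pcompose_pCons flip: rat_const_def)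

text \<open>
  For \<open>S\<close> transcendental over the constants, no denominator vanishes in \<open>rat_comp R S\<close>.
\<close>

definition transc :: "'a::field poly fract \<Rightarrow> bool" where
  "transc S \<longleftrightarrow> (\<forall>p. p \<noteq> 0 \<longrightarrow> poly (map_poly rat_const p) S \<noteq> 0)"

lemma transcD [simp]: "transc S \<Longrightarrow> poly (map_poly rat_const p) S = 0 \<longleftrightarrow> p = 0"
  by (auto simp: transc_def)

text \<open>Cross-multiplying with the chosen lowest terms frees substitution from that choice: any
  fraction representing the expression may be used.\<close>

lemma rat_comp_Fract:
  assumes S: "transc S" and "h \<noteq> 0"
  shows "rat_comp (Fraction_Field.Fract g h) S =
    poly (map_poly rat_const g) S / poly (map_poly rat_const h) S"
proof -
  define R where "R = Fraction_Field.Fract g h"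
  have "is_lowest_terms R (rat_num R) (rat_den R)"
    by (rule is_lowest_terms_num_den)
  then have nz: "rat_den R \<noteq> 0" and "Fraction_Field.Fract g h = Fraction_Field.Fract (rat_num R) (rat_den R)"
    by (auto simp: is_lowest_terms_def R_def)
  then have "g * rat_den R = rat_num R * h"
    using assms by (simp add: eq_fract)
  then have "map_poly rat_const g * map_poly rat_const (rat_den R) =
      map_poly rat_const (rat_num R) * map_poly rat_const h"
    by (metis rat_const.map_poly_mult)
  then have "poly (map_poly rat_const g) S * poly (map_poly rat_const (rat_den R)) S =
      poly (map_poly rat_const (rat_num R)) S * poly (map_poly rat_const h) S"
    by (metis poly_mult)
  then show ?thesis
    using assms nz unfolding R_def[symmetric] rat_comp_def by (simp add: frac_eq_eq)
qed

context
  fixes S :: "'a::field poly fract"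
  assumes S: "transc S"
begin

text \<open>Substituting a transcendental \<open>S\<close> is a field homomorphism, so compositions
  can be simplified as ordinary field expressions.\<close>

lemma field_embedding_rat_comp: "field_embedding (\<lambda>R. rat_comp R S)"
proof
  show "rat_comp 0 S = 0"
    using rat_comp_Fract[OF S, of 1 0] by (simp add: Zero_fract_def)
  show "rat_comp 1 S = 1"
    using rat_comp_Fract[OF S, of 1 1] by (simp add: One_fract_def)
  fix P Q :: "'a poly fract"
  obtain g h where P: "P = Fraction_Field.Fract g h" "h \<noteq> 0" by (cases P) auto
  obtain u v where Q: "Q = Fraction_Field.Fract u v" "v \<noteq> 0" by (cases Q) auto
  show "rat_comp (P + Q) S = rat_comp P S + rat_comp Q S"
    using S P Q by (simp add: rat_comp_Fract add_frac_eq)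
  show "rat_comp (P * Q) S = rat_comp P S * rat_comp Q S"
    using S P Q by (simp add: rat_comp_Fract)
qed

interpretation comp: field_embedding "\<lambda>R. rat_comp R S"
  by (rule field_embedding_rat_comp)

lemmas rat_comp_hom [simp] = comp.zero comp.one comp.add comp.mult comp.diff comp.divide
  comp.power comp.numeral comp.uminus comp.eq_0_iff comp.inverse

lemma rat_comp_to_fract [simp]: "rat_comp (to_fract p) S = poly (map_poly rat_const p) S"
  using rat_comp_Fract[OF S, of 1 p] by (simp add: to_fract_def)

lemma rat_comp_const [simp]: "rat_comp (rat_const c) S = rat_const c"
  using rat_comp_to_fract[of "[:c:]"] by (simp flip: rat_const_def)

lemma rat_comp_X_left [simp]: "rat_comp rat_X S = S"
  using rat_comp_to_fract[of "[:0, 1:]"] by (simp flip: rat_X_def)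

lemma rat_comp_poly:
  "rat_comp (poly (map_poly rat_const p) T) S = poly (map_poly rat_const p) (rat_comp T S)"
  by (induction p) auto

text \<open>A polynomial in the composite is the same polynomial in \<open>T\<close> followed by
  substitution of \<open>S\<close>, and that substitution is injective.\<close>

lemma transc_rat_comp [simp]: "transc T \<Longrightarrow> transc (rat_comp T S)"
  unfolding transc_def[of "rat_comp T S"] by (simp flip: rat_comp_poly)

lemma rat_comp_assoc:
  assumes "transc T"
  shows "rat_comp (rat_comp R T) S = rat_comp R (rat_comp T S)"
proof -
  obtain g h where R: "R = Fraction_Field.Fract g h" "h \<noteq> 0" by (cases R) auto
  with assms show ?thesis by (simp add: rat_comp_Fract rat_comp_poly S)
qed

end

lemma transc_X [simp]: "transc rat_X"
  by (auto simp: transc_def poly_rat_X)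

lemma rat_comp_X_right [simp]: "rat_comp R rat_X = R"
proof -
  obtain g h where R: "R = Fraction_Field.Fract g h" "h \<noteq> 0" by (cases R) auto
  then show ?thesis
    by (simp add: rat_comp_Fract poly_rat_X Fract_conv_to_fract)
qed

text \<open>Clearing denominators in \<open>p(g/h) = 0\<close> leaves one term without a factor
  \<open>h\<close>, a multiple of \<open>g ^ n\<close>. By coprimality \<open>h\<close> is then
  constant, and a nonzero \<open>p\<close> cannot vanish at a nonconstant polynomial.\<close>

lemma transc_Fract:
  fixes g h :: "'a::field poly"
  assumes "h \<noteq> 0" "coprime g h" "Polynomial.degree g > 0 \<or> Polynomial.degree h > 0"
  shows "transc (Fraction_Field.Fract g h)"
  unfolding transc_def
proof (intro allI impI notI)
  fix p :: "'a poly"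
  define S where "S = Fraction_Field.Fract g h"
  assume p: "p \<noteq> 0" and root: "poly (map_poly rat_const p) (Fraction_Field.Fract g h) = 0"
  define n where "n = Polynomial.degree p"
  have Sh: "S = to_fract g / to_fract h" by (simp add: S_def Fract_conv_to_fract)
  have pow: "to_fract (q ^ i) = to_fract q ^ i" for q :: "'a poly" and i
    by (induction i) auto
  have "to_fract h ^ n * poly (map_poly rat_const p) S =
      (\<Sum>i\<le>n. rat_const (Polynomial.coeff p i) * (to_fract h ^ n * S ^ i))"
    by (simp add: poly_altdef n_def sum_distrib_left mult_ac)
  also have "\<dots> = (\<Sum>i\<le>n. to_fract (Polynomial.smult (Polynomial.coeff p i) (g ^ i * h ^ (n - i))))"
  proof (intro sum.cong refl)
    fix i assume "i \<in> {..n}"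
    then have "to_fract h ^ n = to_fract h ^ (n - i) * to_fract h ^ i"
      by (simp flip: power_add)
    then show "rat_const (Polynomial.coeff p i) * (to_fract h ^ n * S ^ i) =
        to_fract (Polynomial.smult (Polynomial.coeff p i) (g ^ i * h ^ (n - i)))"
      using assms by (simp add: to_fract_smult pow Sh power_divide)
  qed
  finally have zero: "(\<Sum>i\<le>n. Polynomial.smult (Polynomial.coeff p i) (g ^ i * h ^ (n - i))) = 0"
    using root by (simp add: S_def flip: to_fract_sum)
  define rest where "rest = (\<Sum>i<n. Polynomial.smult (Polynomial.coeff p i) (g ^ i * h ^ (n - i)))"
  have "h dvd rest"
    unfolding rest_def by (intro dvd_sum dvd_smult dvd_mult) (auto intro: dvd_power)
  moreover have "rest + Polynomial.smult (Polynomial.coeff p n) (g ^ n) = 0"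
    using zero unfolding rest_def lessThan_Suc_atMost[symmetric] by simp
  ultimately have "h dvd Polynomial.smult (Polynomial.coeff p n) (g ^ n)"
    by (metis dvd_0_right dvd_add_right_iff)
  then have "h dvd g ^ n"
    using p by (simp add: n_def dvd_smult_iff)
  \<comment> \<open>The factors \<open>g\<close> are cancelled one at a time until \<open>h\<close>
    divides 1.\<close>
  then have "is_unit h"
    by (induction n) (auto dest: coprime_poly_dvd_mult[OF assms(2)])
  then obtain c where h: "h = [:c:]" "c \<noteq> 0"
    using assms(1) by (metis is_unit_poly_iff pCons_0_0)
  define k where "k = Polynomial.smult (inverse c) g"
  have "S = to_fract k"
    unfolding k_def to_fract_smult Sh h rat_const_def[symmetric] by (simp add: divide_inverse mult.commute)
  then have "pcompose p k = 0"
    using root by (simp add: S_def poly_to_fract)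
  moreover have "Polynomial.degree k > 0"
    using assms h by (simp add: k_def)
  ultimately show False
    using p by (simp add: pcompose_eq_0_iff)
qed

subsection \<open>Moebius transformations and equivalence\<close>

text \<open>Numerators divide each other, and so do denominators. Hence \<open>rat_degree\<close>
  can be read off from any coprime representation.\<close>

lemma is_lowest_terms_unique_degree:
  assumes "is_lowest_terms R g h" "is_lowest_terms R g' h'"
  shows "Polynomial.degree g = Polynomial.degree g'" "Polynomial.degree h = Polynomial.degree h'"
proof -
  have *: "h dvd h' \<and> g dvd g'"
    if "is_lowest_terms R g h" "is_lowest_terms R g' h'" for g h g' h'
  proof -
    have eq: "g * h' = h * g'"
      using that by (auto simp: is_lowest_terms_def eq_fract mult.commute)
    have "coprime g h" "coprime h g"
      using that by (auto simp: is_lowest_terms_def coprime_commute)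
    then show ?thesis
      using coprime_poly_dvd_mult[of g h h'] coprime_poly_dvd_mult[of h g g']
      by (metis dvd_triv_left eq)
  qed
  have deg: "Polynomial.degree p = Polynomial.degree q" if "p dvd q" "q dvd p" for p q :: "'a poly"
    using that by (metis dvd_0_left_iff dvd_imp_degree_le dual_order.antisym)
  show "Polynomial.degree g = Polynomial.degree g'" "Polynomial.degree h = Polynomial.degree h'"
    using *[OF assms] *[OF assms(2,1)] deg by auto
qed

lemma rat_degree_Fract:
  assumes "h \<noteq> 0" "coprime g h"
  shows "rat_degree (Fraction_Field.Fract g h) = max (Polynomial.degree g) (Polynomial.degree h)"
  using is_lowest_terms_unique_degree[OF is_lowest_terms_num_den, of "Fraction_Field.Fract g h" g h]
    assms by (simp add: rat_degree_def is_lowest_terms_def)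

text \<open>This is \<open>(a x + b) / (c x + d)\<close>, given by the matrix with rows
  \<open>a b\<close> and \<open>c d\<close>; coefficient lists start with the constant term.\<close>

definition mob :: "'a::field \<Rightarrow> 'a \<Rightarrow> 'a \<Rightarrow> 'a \<Rightarrow> 'a poly fract" where
  "mob a b c d = Fraction_Field.Fract [:b, a:] [:d, c:]"

definition mobius :: "'a::field poly fract set" where
  "mobius = {mob a b c d | a b c d. a * d \<noteq> b * c}"

lemma mobiusI: "a * d \<noteq> b * c \<Longrightarrow> mob a b c d \<in> mobius"
  by (auto simp: mobius_def)

lemma coprime_mob:
  fixes a b c d :: "'a::field"
  assumes "a * d \<noteq> b * c"
  shows "coprime [:b, a:] [:d, c:]"
proof (rule coprimeI)
  fix p assume p: "p dvd [:b, a:]" "p dvd [:d, c:]"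
  then have "p dvd Polynomial.smult a [:d, c:] - Polynomial.smult c [:b, a:]"
    by (intro dvd_diff dvd_smult)
  also have "\<dots> = [:a * d - b * c:]" by (simp add: mult.commute)
  finally show "is_unit p"
    using assms by (metis dvd_trans eq_iff_diff_eq_0 is_unit_const_poly_iff dvd_field_iff)
qed

lemma mob_cases:
  assumes "M \<in> mobius"
  obtains a b c d where "M = mob a b c d" "a * d \<noteq> b * c" "[:d, c:] \<noteq> 0"
proof -
  from assms obtain a b c d where "M = mob a b c d" "a * d \<noteq> b * c"
    by (auto simp: mobius_def)
  moreover from this have "[:d, c:] \<noteq> 0" by auto
  ultimately show thesis by (rule that)
qed

lemma rat_degree_mobius:
  assumes "M \<in> mobius"
  shows "rat_degree M = 1"
  using assms by (elim mob_cases) (auto simp: mob_def rat_degree_Fract coprime_mob)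

lemma transc_mobius [simp]:
  assumes "M \<in> mobius"
  shows "transc M"
  using assms by (elim mob_cases) (auto simp: mob_def intro!: transc_Fract coprime_mob)

lemma rat_comp_mob:
  assumes "transc S" "a * d \<noteq> b * c"
  shows "rat_comp (mob a b c d) S =
    (rat_const a * S + rat_const b) / (rat_const c * S + rat_const d)"
  using assms unfolding mob_def by (subst rat_comp_Fract) (auto simp: algebra_simps)

lemma transc_linear_nonzero:
  assumes "transc S" "c \<noteq> 0 \<or> d \<noteq> 0"
  shows "rat_const c * S + rat_const d \<noteq> 0"
  using transcD[OF assms(1), of "[:d, c:]"] assms(2) by (auto simp: algebra_simps)

text \<open>Composition corresponds to the matrix product, and the second claim is multiplicativity
  of the determinant.\<close>

lemma rat_comp_mob_mob:
  assumes "transc S" "a * d \<noteq> b * c" "a' * d' \<noteq> b' * c'"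
  shows "rat_comp (mob a b c d) (rat_comp (mob a' b' c' d') S) =
    rat_comp (mob (a * a' + b * c') (a * b' + b * d') (c * a' + d * c') (c * b' + d * d')) S"
    and "(a * a' + b * c') * (c * b' + d * d') \<noteq> (a * b' + b * d') * (c * a' + d * c')"
proof -
  have "(a * a' + b * c') * (c * b' + d * d') - (a * b' + b * d') * (c * a' + d * c') =
      (a * d - b * c) * (a' * d' - b' * c')"
    by (simp add: algebra_simps)
  with assms show det: "(a * a' + b * c') * (c * b' + d * d') \<noteq> (a * b' + b * d') * (c * a' + d * c')"
    by auto
  have T: "transc (rat_comp (mob a' b' c' d') S)"
    using assms by (simp add: mobiusI)
  define P Q where "P = rat_const a' * S + rat_const b'" and "Q = rat_const c' * S + rat_const d'"
  have Q: "Q \<noteq> 0"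
    unfolding Q_def using assms by (intro transc_linear_nonzero) auto
  have "rat_comp (mob a b c d) (rat_comp (mob a' b' c' d') S) =
      (rat_const a * (P / Q) + rat_const b) / (rat_const c * (P / Q) + rat_const d)"
    unfolding rat_comp_mob[OF T assms(2)] unfolding rat_comp_mob[OF assms(1,3)] P_def Q_def ..
  also have "\<dots> = (rat_const a * P + rat_const b * Q) / (rat_const c * P + rat_const d * Q)"
    using Q by (simp add: add_divide_eq_iff divide_add_eq_iff)
  also have "\<dots> = rat_comp (mob (a * a' + b * c') (a * b' + b * d') (c * a' + d * c') (c * b' + d * d')) S"
    unfolding rat_comp_mob[OF assms(1) det] P_def Q_def by (simp add: algebra_simps)
  finally show "rat_comp (mob a b c d) (rat_comp (mob a' b' c' d') S) = \<dots>" .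
qed

lemma mobius_comp:
  assumes "B \<in> mobius" "M \<in> mobius"
  shows "rat_comp B M \<in> mobius"
proof -
  from assms obtain a b c d a' b' c' d' where
    "B = mob a b c d" "a * d \<noteq> b * c" "M = mob a' b' c' d'" "a' * d' \<noteq> b' * c'"
    by (auto simp: mobius_def)
  then show ?thesis
    using rat_comp_mob_mob[OF transc_X, of a d b c a' d' b' c'] by (simp add: mobiusI)
qed

lemma mob_X: "mob 1 0 0 1 = rat_X"
  by (simp add: mob_def rat_X_def to_fract_def one_pCons)

lemma X_in_mobius [simp]: "rat_X \<in> mobius"
  by (metis mob_X mobiusI mult_1 mult_zero_left zero_neq_one)

lemma mob_scale:
  assumes "e \<noteq> 0" "a * d \<noteq> b * c"
  shows "mob (e * a) (e * b) (e * c) (e * d) = mob a b c d"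
proof -
  have "[:d, c:] \<noteq> 0" "[:e * d, e * c:] \<noteq> 0" using assms by auto
  then show ?thesis
    by (simp add: mob_def eq_fract algebra_simps del: pCons_eq_0_iff)
qed

text \<open>The adjugate matrix gives the inverse: both products are the determinant times the
  identity, and scalars act trivially by \<open>mob_scale\<close>.\<close>

lemma mobius_inv:
  assumes "M \<in> mobius"
  obtains A where "A \<in> mobius" "rat_comp A M = rat_X" "rat_comp M A = rat_X"
proof -
  from assms obtain a b c d where M: "M = mob a b c d" and det: "a * d \<noteq> b * c"
    by (rule mob_cases)
  have *: "mob x 0 0 x = rat_X" if "x \<noteq> 0" for x :: 'a
    using mob_scale[of x 1 1 0 0] that by (simp add: mob_X)
  have det': "d * a \<noteq> (- b) * (- c)"
    using det by (simp add: mult.commute)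
  show thesis
  proof (rule that)
    show "mob d (- b) (- c) a \<in> mobius"
      using det' by (rule mobiusI)
    show "rat_comp (mob d (- b) (- c) a) M = rat_X"
      using rat_comp_mob_mob(1)[OF transc_X det' det] det *[of "a * d - b * c"]
      by (simp add: M algebra_simps)
    show "rat_comp M (mob d (- b) (- c) a) = rat_X"
      using rat_comp_mob_mob(1)[OF transc_X det det'] det *[of "a * d - b * c"]
      by (simp add: M algebra_simps)
  qed
qed

text \<open>Uniqueness in the definite description comes directly from associativity:
  \<open>N\<close> equals \<open>N\<close> composed with \<open>A\<close> and then \<open>M\<close>,
  which is \<open>M\<close>.\<close>

lemma inv_PGL2:
  assumes "A \<in> mobius" "M \<in> mobius" "rat_comp A M = rat_X" "rat_comp M A = rat_X"
  shows "inv\<^bsub>PGL2\<^esub> A = M"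
  unfolding m_inv_def
proof (rule the_equality)
  show "M \<in> carrier PGL2 \<and> A \<otimes>\<^bsub>PGL2\<^esub> M = \<one>\<^bsub>PGL2\<^esub> \<and> M \<otimes>\<^bsub>PGL2\<^esub> A = \<one>\<^bsub>PGL2\<^esub>"
    using assms by (simp add: PGL2_def rat_degree_mobius)
  fix N assume "N \<in> carrier PGL2 \<and> A \<otimes>\<^bsub>PGL2\<^esub> N = \<one>\<^bsub>PGL2\<^esub> \<and> N \<otimes>\<^bsub>PGL2\<^esub> A = \<one>\<^bsub>PGL2\<^esub>"
  then have "rat_comp N A = rat_X" by (simp add: PGL2_def)
  then have "rat_comp (rat_comp N A) M = M" using assms by simp
  then show "N = M" using assms by (simp add: rat_comp_assoc)
qed

text \<open>A working form of equivalence: \<open>M\<close> takes the place of the inverse of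
  \<open>A\<close>, and transcendence is included so that compositions can be reassociated.\<close>

definition eqv :: "'a::field poly fract \<Rightarrow> 'a poly fract \<Rightarrow> bool" where
  "eqv R S \<longleftrightarrow> transc R \<and> (\<exists>B\<in>mobius. \<exists>M\<in>mobius. S = rat_comp B (rat_comp R M))"

lemma eqv_imp_rat_equivalent:
  assumes "eqv R S"
  shows "rat_equivalent R S"
proof -
  from assms obtain B M where BM: "B \<in> mobius" "M \<in> mobius" "S = rat_comp B (rat_comp R M)"
    by (auto simp: eqv_def)
  from BM(2) obtain A where A: "A \<in> mobius" "rat_comp A M = rat_X" "rat_comp M A = rat_X"
    by (rule mobius_inv)
  then have "S = mobius_act (B, A) R"
    using BM by (simp add: mobius_act_def inv_PGL2)
  moreover have "(B, A) \<in> carrier (PGL2 \<times>\<times> PGL2)"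
    using A BM by (simp add: PGL2_def rat_degree_mobius)
  ultimately show ?thesis
    unfolding rat_equivalent_def orbit_def by blast
qed

lemma eqv_transc: "eqv R S \<Longrightarrow> transc S"
  by (auto simp: eqv_def)

lemma eqv_trans:
  assumes "eqv R S" "eqv S T"
  shows "eqv R T"
proof -
  from assms obtain B M B' M' where BM: "B \<in> mobius" "M \<in> mobius" "S = rat_comp B (rat_comp R M)"
     "B' \<in> mobius" "M' \<in> mobius" "T = rat_comp B' (rat_comp S M')" and R: "transc R"
    by (auto simp: eqv_def)
  then have "T = rat_comp (rat_comp B' B) (rat_comp R (rat_comp M M'))"
    by (simp add: rat_comp_assoc)
  then show ?thesis
    unfolding eqv_def using BM R mobius_comp by blast
qed

lemma eqv_left:
  assumes "transc R" "B \<in> mobius"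
  shows "eqv R (rat_comp B R)"
  using assms unfolding eqv_def
  by (intro conjI bexI[of _ B] bexI[of _ rat_X]) simp_all

lemma eqv_right:
  assumes "transc R" "M \<in> mobius"
  shows "eqv R (rat_comp R M)"
  using assms unfolding eqv_def
  by (intro conjI bexI[of _ rat_X] bexI[of _ M]) simp_all

subsection \<open>Double roots and nonsquares\<close>

text \<open>The leading coefficient is multiplied by the degree, which is nonzero in the field
  because it lies strictly between 0 and the characteristic.\<close>

lemma pderiv_nonzero:
  fixes p :: "'a::field poly"
  assumes "Polynomial.degree p > 0" "Polynomial.degree p < CHAR('a)"
  shows "pderiv p \<noteq> 0"
proof -
  have "\<not> CHAR('a) dvd Polynomial.degree p"
    using assms by (auto dest: dvd_imp_le)
  then have "Polynomial.coeff (pderiv p) (Polynomial.degree p - 1) \<noteq> 0"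
    using assms by (simp add: coeff_pderiv of_nat_eq_0_iff_char_dvd) auto
  then show ?thesis by auto
qed

lemma degree_pderiv_less:
  assumes "Polynomial.degree p > 0"
  shows "Polynomial.degree (pderiv p) < Polynomial.degree p"
proof -
  have "Polynomial.degree (pderiv p) \<le> Polynomial.degree p - 1"
    by (rule degree_le) (auto simp: coeff_pderiv coeff_eq_0)
  with assms show ?thesis by linarith
qed

text \<open>With \<open>W = p * u\<close> and \<open>p\<close> minimal for \<alpha>, the derivative
  of \<open>W\<close> at \<alpha> is \<open>p'(\<alpha>) u(\<alpha>)\<close>. The degree bound makes
  \<open>p'\<close> nonzero of smaller degree than \<open>p\<close>, so \<open>p'(\<alpha>)\<close>
  is nonzero and \<open>p\<close> divides \<open>u\<close>.\<close>

lemma minimal_poly_factor: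
  fixes f :: "'a::field \<Rightarrow> 'b::field"
  assumes "field_embedding f"
  assumes "W \<noteq> 0" "poly (map_poly f W) \<alpha> = 0" "poly (pderiv (map_poly f W)) \<alpha> = 0"
  assumes "Polynomial.degree W < CHAR('a)"
  obtains p where "p ^ 2 dvd W" "Polynomial.degree p > 0" 
    "\<And>r. poly (map_poly f r) \<alpha> = 0 \<longleftrightarrow> p dvd r"
proof -
  interpret field_embedding f by fact
  obtain p where p: "p \<noteq> 0" "\<And>r. poly (map_poly f r) \<alpha> = 0 \<longleftrightarrow> p dvd r"
    using ex_minimal_poly[OF assms(2,3)] by metis
  then have "p dvd W" using assms by simp
  then obtain u where u: "W = p * u" by (auto elim: dvdE)
  have deg: "Polynomial.degree p > 0"
  proof (rule ccontr)
    assume "\<not> ?thesis"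
    then have "p dvd 1" using p(1) by (simp add: is_unit_iff_degree)
    then show False using p(2)[of 1] by simp
  qed
  have "p dvd p" by simp
  then have p\<alpha>: "poly (map_poly f p) \<alpha> = 0" using p by blast
  have "Polynomial.degree p < CHAR('a)"
    using assms(2,5) u by (auto simp: degree_mult_eq)
  then have "pderiv p \<noteq> 0" and "Polynomial.degree (pderiv p) < Polynomial.degree p"
    using deg by (simp_all add: pderiv_nonzero degree_pderiv_less)
  then have "\<not> p dvd pderiv p"
    by (auto dest: dvd_imp_degree_le)
  then have "poly (pderiv (map_poly f p)) \<alpha> \<noteq> 0"
    using p(2)[of "pderiv p"] by (simp add: map_poly_pderiv)
  moreover have "poly (pderiv (map_poly f p)) \<alpha> * poly (map_poly f u) \<alpha> = 0"
    using assms(4) p\<alpha> by (auto simp: u pderiv_mult)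
  ultimately have "p dvd u" using p by simp
  then have "p ^ 2 dvd W" by (simp add: u power2_eq_square)
  with deg p(2) show thesis using that by blast
qed

lemma order_ge_2:
  fixes p :: "'a::field poly"
  assumes "p \<noteq> 0" "poly p a = 0" "poly (pderiv p) a = 0"
  shows "order a p > 1"
proof -
  obtain u where u: "p = [:- a, 1:] * u"
    using assms(2) by (auto simp: poly_eq_0_iff_dvd elim: dvdE)
  then have "poly u a = 0"
    using assms(3) by (simp only: u pderiv_mult) (simp add: pderiv_pCons)
  then have "[:- a, 1:] ^ 2 dvd p"
    unfolding u power2_eq_square by (intro mult_dvd_mono) (simp_all add: poly_eq_0_iff_dvd)
  then show ?thesis
    using assms(1) by (simp add: order_divides)
qed

text \<open>The polynomial splits into as many linear factors as its degree; with fewer distinct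
  roots, some root occurs twice.\<close>

lemma double_root_of_few_roots:
  fixes p :: "'a::alg_closed_field poly"
  assumes "p \<noteq> 0" "card {x. poly p x = 0} < Polynomial.degree p"
  obtains x where "poly p x = 0" "poly (pderiv p) x = 0"
proof -
  obtain A where A: "size A = Polynomial.degree p"
    "p = Polynomial.smult (lead_coeff p) (\<Prod>x\<in>#A. [:-x, 1:])"
    using alg_closed_imp_factorization[OF assms(1)] by blast
  have roots: "{x. poly p x = 0} = set_mset A"
    using assms(1) by (subst A(2)) (auto simp: poly_prod_mset)
  have "\<exists>x. count A x > 1"
  proof (rule ccontr)
    assume *: "\<not> ?thesis"
    have "size A = (\<Sum>x\<in>set_mset A. count A x)" by (rule size_multiset_overloaded_eq)
    also have "\<dots> \<le> (\<Sum>x\<in>set_mset A. 1)"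
      using * by (intro sum_mono) (auto simp: not_less)
    finally show False using A(1) assms(2) roots by simp
  qed
  then obtain x where x: "count A x > 1" by blast
  then have "{#x, x#} \<subseteq># A"
    by (auto simp: subseteq_mset_def)
  then obtain B where B: "A = {#x, x#} + B"
    by (auto simp: mset_subset_eq_exists_conv)
  have "p = Polynomial.smult (lead_coeff p) ([:- x, 1:] * ([:- x, 1:] * (\<Prod>x\<in>#B. [:-x, 1:])))"
    by (subst A(2)) (simp add: B)
  then obtain q where q: "p = [:- x, 1:] * ([:- x, 1:] * q)"
    by (metis mult_smult_right)
  show thesis
  proof
    show "poly p x = 0" by (simp add: q)
    show "poly (pderiv p) x = 0" by (simp only: q pderiv_mult) simp
  qed
qed

text \<open>Squaring is at most two-to-one, so the nonzero squares \<open>Q\<close> fill at least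
  half of \<open>U\<close>. The coset \<open>Q'\<close> is disjoint from \<open>Q\<close> and
  equally large, so the two exhaust \<open>U\<close>.\<close>

lemma nonsquare_ratio:
  fixes \<sigma> c :: "'a::{field, finite}"
  assumes "\<nexists>y. \<sigma> = y ^ 2" "\<nexists>y. c = y ^ 2"
  obtains t where "c = \<sigma> * t ^ 2" "t \<noteq> 0"
proof -
  define U where "U = (UNIV - {0} :: 'a set)"
  define Q where "Q = (\<lambda>x. x ^ 2) ` U"
  have [simp]: "finite U" "finite Q" by simp_all
  have nz: "\<sigma> \<noteq> 0" "c \<noteq> 0"
    using assms by (metis zero_power2)+
  have "U = (\<Union>q\<in>Q. {x. x ^ 2 = q})"
    by (auto simp: Q_def U_def)
  then have "card U \<le> (\<Sum>q\<in>Q. card {x. x ^ 2 = q})"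
    by (metis card_UN_le \<open>finite Q\<close>)
  also have "\<dots> \<le> (\<Sum>q\<in>Q. 2)"
  proof (rule sum_mono)
    fix q assume "q \<in> Q"
    then obtain y where "q = y ^ 2" by (auto simp: Q_def)
    then have "{x. x ^ 2 = q} = {y, - y}" by (auto simp: power2_eq_iff)
    then show "card {x. x ^ 2 = q} \<le> 2" by (simp add: card_insert_le_m1)
  qed
  finally have le: "card U \<le> 2 * card Q" by simp
  define Q' where "Q' = (\<lambda>x. \<sigma> * x) ` Q"
  have "card Q' = card Q"
    unfolding Q'_def using nz by (intro card_image) (auto simp: inj_on_def)
  moreover have "Q \<inter> Q' = {}"
  proof (rule ccontr)
    assume "Q \<inter> Q' \<noteq> {}"
    then obtain x y where xy: "x ^ 2 = \<sigma> * y ^ 2" "y \<noteq> 0" by (auto simp: Q_def Q'_def U_def)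
    then have "\<sigma> = (x / y) ^ 2" by (simp add: power_divide)
    then show False using assms by blast
  qed
  ultimately have "card (Q \<union> Q') \<ge> card U"
    using le by (simp add: card_Un_disjoint Q'_def)
  moreover have "Q \<union> Q' \<subseteq> U"
    using nz by (auto simp: Q_def Q'_def U_def)
  ultimately have "Q \<union> Q' = U"
    by (simp add: card_seteq)
  then have "c \<in> Q \<union> Q'" using nz by (simp add: U_def)
  moreover have "c \<notin> Q" using assms by (auto simp: Q_def)
  ultimately show thesis using that by (auto simp: Q_def Q'_def U_def)
qed

subsection \<open>The Wronskian and ramification\<close>

text \<open>The numerator of the derivative of \<open>g / h\<close>. For a cubic
  \<open>g / h\<close> it dehomogenizes a quartic form, whose multiplicity at infinity is the amount
  by which the degree falls below four.\<close>

definition wronskian :: "'a::field poly \<Rightarrow> 'a poly \<Rightarrow> 'a poly" where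
  "wronskian g h = pderiv g * h - g * pderiv h"

lemma wronskian_pcompose:
  "wronskian (pcompose g k) (pcompose h k) = pcompose (wronskian g h) k * pderiv k"
  by (simp add: wronskian_def pderiv_pcompose pcompose_diff pcompose_mult algebra_simps)

text \<open>If it vanished, coprimality would make \<open>g\<close> and \<open>h\<close> divide
  their own derivatives, forcing both to be constant below the characteristic.\<close>

lemma wronskian_nonzero:
  fixes g h :: "'a::field poly"
  assumes "coprime g h" "Polynomial.degree g < CHAR('a)" "Polynomial.degree h < CHAR('a)"
    and "Polynomial.degree g > 0 \<or> Polynomial.degree h > 0"
  shows "wronskian g h \<noteq> 0"
proof
  assume "wronskian g h = 0"
  then have eq: "h * pderiv g = g * pderiv h" by (simp add: wronskian_def mult.commute)
  have *: "Polynomial.degree p = 0" if "p dvd pderiv p" "Polynomial.degree p < CHAR('a)" for p :: "'a poly"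
    using that pderiv_nonzero[of p] degree_pderiv_less[of p] dvd_imp_degree_le[of p "pderiv p"]
    by linarith
  have "g dvd pderiv g"
    using coprime_poly_dvd_mult[of h g "pderiv g"] assms(1) eq by (simp add: coprime_commute)
  moreover have "h dvd pderiv h"
    using coprime_poly_dvd_mult[of g h "pderiv h"] assms(1) by (metis eq dvd_triv_left)
  ultimately show False using * assms by fastforce
qed

lemma coprime_pcompose:
  fixes g h :: "'a::field poly"
  assumes "coprime g h"
  shows "coprime (pcompose g k) (pcompose h k)"
proof -
  obtain a b where "a * g + b * h = 1"
    using assms by (rule poly_bezout)
  then have eq: "pcompose a k * pcompose g k + pcompose b k * pcompose h k = 1"
    by (metis pcompose_1 pcompose_add pcompose_mult)
  show ?thesis
  proof (rule coprimeI)
    fix c assume "c dvd pcompose g k" "c dvd pcompose h k"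
    then have "c dvd pcompose a k * pcompose g k + pcompose b k * pcompose h k"
      by (intro dvd_add dvd_mult)
    then show "is_unit c" by (simp add: eq)
  qed
qed

lemma rat_comp_affine:
  fixes g h :: "'a::field poly"
  assumes "h \<noteq> 0" "t \<noteq> 0"
  shows "rat_comp (Fraction_Field.Fract g h) (mob t b 0 1) =
    Fraction_Field.Fract (pcompose g [:b, t:]) (pcompose h [:b, t:])"
proof -
  have "transc (mob t b 0 1)" using assms by (simp add: mobiusI)
  moreover have "mob t b 0 1 = to_fract [:b, t:]"
    by (simp add: mob_def to_fract_def one_pCons)
  ultimately show ?thesis
    using assms by (simp add: rat_comp_Fract poly_to_fract Fract_conv_to_fract)
qed

lemma no_common_root:
  assumes "coprime g h" "poly (map_poly to_ac g) a = 0" "poly (map_poly to_ac h) a = 0"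
  shows False
proof -
  obtain u v where "u * g + v * h = 1"
    using assms(1) by (rule poly_bezout)
  then have "map_poly to_ac u * map_poly to_ac g + map_poly to_ac v * map_poly to_ac h = 1"
    by (metis to_ac.map_poly_add to_ac.map_poly_mult map_poly_1' to_ac_1)
  then have "poly (map_poly to_ac u * map_poly to_ac g + map_poly to_ac v * map_poly to_ac h) a = 1"
    by simp
  then show False using assms by simp
qed

lemma rat_num_den:
  "rat_den R \<noteq> 0" "coprime (rat_num R) (rat_den R)" "R = Fraction_Field.Fract (rat_num R) (rat_den R)"
  using is_lowest_terms_num_den[of R] by (auto simp: is_lowest_terms_def)

text \<open>At a pole, \<open>g\<close> does not vanish, so the zero of the Wronskian is a zero of
  \<open>h'\<close>. Elsewhere the derivative of \<open>g - b h\<close> at \<open>a\<close> is the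
  Wronskian divided by \<open>h(a)\<close>.\<close>

lemma ramified_Finite:
  assumes "rat_degree R > 0" "poly (map_poly to_ac (wronskian (rat_num R) (rat_den R))) a = 0"
  shows "Finite a \<in> ramification_points R"
proof -
  define G H where "G = ac_num R" and "H = ac_den R"
  have W: "poly (pderiv G) a * poly H a = poly G a * poly (pderiv H) a"
    using assms(2) by (simp add: wronskian_def G_def H_def ac_num_def ac_den_def to_ac.map_poly_pderiv)
  have no_common: False if "poly G x = 0" "poly H x = 0" for x
    using no_common_root[OF rat_num_den(2)] that by (auto simp: G_def H_def ac_num_def ac_den_def)
  have H0: "H \<noteq> 0" by (simp add: H_def ac_den_def rat_num_den)
  have deg: "Polynomial.degree G > 0 \<or> Polynomial.degree H > 0"
    using assms(1) by (auto simp: rat_degree_def G_def H_def ac_num_def ac_den_def)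
  show ?thesis
  proof (cases "poly H a = 0")
    case True
    then have "poly (pderiv H) a = 0" using W no_common by auto
    then show ?thesis
      using True H0 order_ge_2[of H a]
      by (simp add: ramification_points_def ram_index_def flip: H_def)
  next
    case False
    define b where "b = poly G a / poly H a"
    define K where "K = G - Polynomial.smult b H"
    \<comment> \<open>Otherwise \<open>G\<close> is a multiple of \<open>H\<close>, so
      \<open>H\<close> is nonconstant and its roots are common roots.\<close>
    have "K \<noteq> 0"
    proof
      assume "K = 0"
      then have G: "G = Polynomial.smult b H" by (simp add: K_def)
      then have "Polynomial.degree H > 0" using deg by (auto split: if_splits)
      then obtain x where "poly H x = 0"
        using alg_closed_imp_poly_has_root by blast
      then show False using no_common[of x] G by simp
    qed
    moreover have "poly K a = 0" "poly (pderiv K) a = 0"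
      using False W by (simp_all add: K_def b_def pderiv_diff pderiv_smult field_simps)
    ultimately have "order a K > 1" by (rule order_ge_2)
    then show ?thesis
      using False by (simp add: ramification_points_def ram_index_def K_def b_def G_def H_def)
  qed
qed

text \<open>With \<open>d = n + 2\<close>, the equation says that the coefficient of degree
  \<open>2 d - 2\<close> of the Wronskian vanishes. The fibre polynomial over the image of infinity
  lacks its top coefficient by construction, and the equation removes the next one.\<close>

lemma ramified_Infinity:
  assumes "rat_degree R = Suc (Suc n)"
    and "Polynomial.coeff (rat_num R) (Suc (Suc n)) * Polynomial.coeff (rat_den R) (Suc n) =
         Polynomial.coeff (rat_num R) (Suc n) * Polynomial.coeff (rat_den R) (Suc (Suc n))"
  shows "Infinity \<in> ramification_points R"
proof -
  define G H where "G = ac_num R" and "H = ac_den R"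
  define Q where "Q = rat_map R Infinity"
  have max: "max (Polynomial.degree G) (Polynomial.degree H) = Suc (Suc n)"
    using assms(1) by (simp add: rat_degree_def G_def H_def ac_num_def ac_den_def)
  have eq: "Polynomial.coeff G (Suc (Suc n)) * Polynomial.coeff H (Suc n) =
      Polynomial.coeff G (Suc n) * Polynomial.coeff H (Suc (Suc n))"
    using arg_cong[OF assms(2), of to_ac] by (simp add: G_def H_def ac_num_def ac_den_def)
  have "Polynomial.degree (fibre_poly R Q) \<le> n"
  proof (rule degree_le, intro allI impI)
    fix i assume "n < i"
    then consider "i = Suc n" | "i = Suc (Suc n)" | "i > Suc (Suc n)" by linarith
    then have "Polynomial.coeff H i = 0" if "Polynomial.coeff H (Suc (Suc n)) = 0"
    proof cases
      case 1
      \<comment> \<open>Since \<open>H\<close> lacks the top coefficient, \<open>G\<close> must have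
        it, so it can be cancelled from \<open>eq\<close>.\<close>
      have "Polynomial.degree H \<noteq> Suc (Suc n)"
        using that by (metis Zero_not_Suc degree_0 leading_coeff_0_iff)
      then have "Polynomial.degree G = Suc (Suc n)" using max by linarith
      then have "Polynomial.coeff G (Suc (Suc n)) \<noteq> 0"
        by (metis Zero_not_Suc degree_0 leading_coeff_0_iff)
      then show ?thesis using eq that 1 by simp
    next
      case 3
      then show ?thesis using max by (intro coeff_eq_0) linarith
    qed (use that in simp)
    moreover have "Polynomial.coeff (G - Polynomial.smult
        (Polynomial.coeff G (Suc (Suc n)) / Polynomial.coeff H (Suc (Suc n))) H) i = 0"
      if "Polynomial.coeff H (Suc (Suc n)) \<noteq> 0"
      using \<open>n < i\<close>
    proof -
      consider "i = Suc n" | "i = Suc (Suc n)" | "i > Suc (Suc n)" using \<open>n < i\<close> by linarith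
      then show ?thesis
      proof cases
        case 3
        then have "Polynomial.coeff G i = 0" "Polynomial.coeff H i = 0"
          using max by (auto intro!: coeff_eq_0)
        then show ?thesis by simp
      qed (use that eq in \<open>auto simp: field_simps\<close>)
    qed
    ultimately show "Polynomial.coeff (fibre_poly R Q) i = 0"
      by (simp add: Q_def assms(1) G_def H_def)
  qed
  then show ?thesis
    using assms(1) by (simp add: ramification_points_def ram_index_def Q_def)
qed

subsection \<open>Normal forms of cubic expressions\<close>

lemma cubic_conv_coeffs:
  assumes "Polynomial.degree p \<le> 3"
  shows "p = [:Polynomial.coeff p 0, Polynomial.coeff p 1, Polynomial.coeff p 2, Polynomial.coeff p 3:]"
proof (rule poly_eqI)
  fix n :: nat
  consider "n = 0" | "n = 1" | "n = 2" | "n = 3" | "n > 3" by linarith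
  then show "Polynomial.coeff p n = Polynomial.coeff
      [:Polynomial.coeff p 0, Polynomial.coeff p 1, Polynomial.coeff p 2, Polynomial.coeff p 3:] n"
    by cases (use assms in \<open>auto simp: numeral_2_eq_2 numeral_3_eq_3 coeff_pCons coeff_eq_0 split: nat.splits\<close>)
qed

text \<open>The coefficients are combinations of the 2 by 2 minors of the coefficient matrix of the
  pair.\<close>

lemma wronskian_cubic:
  "wronskian [:g0, g1, g2, g3:] [:h0, h1, h2, h3:] =
    [:g1 * h0 - g0 * h1, 2 * (g2 * h0 - g0 * h2), 3 * (g3 * h0 - g0 * h3) + (g2 * h1 - g1 * h2),
      2 * (g3 * h1 - g1 * h3), g3 * h2 - g2 * h3:]"
  by (simp add: wronskian_def pderiv_pCons algebra_simps)

text \<open>A translation removes the quadratic term; an affine map on the left then removes the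
  constant term and makes the cubic monic.\<close>

lemma eqv_depressed_cubic:
  fixes k0 k1 k2 k3 :: "'a::field"
  assumes "k3 \<noteq> 0" "(3::'a) \<noteq> 0"
  obtains e where "eqv (to_fract [:k0, k1, k2, k3:]) (rat_X ^ 3 + rat_const e * rat_X)"
proof -
  define s where "s = - k2 / (3 * k3)"
  \<comment> \<open>These are the values at \<open>s\<close> of the cubic and of its derivative, the
    lowest Taylor coefficients there.\<close>
  define m0 m1 where "m0 = k0 + k1 * s + k2 * s ^ 2 + k3 * s ^ 3"
    and "m1 = k1 + 2 * k2 * s + 3 * k3 * s ^ 2"
  have s: "k2 + 3 * k3 * s = 0"
    using assms by (simp add: s_def)
  have "pcompose [:k0, k1, k2, k3:] [:s, 1:] = [:m0, m1, k2 + 3 * k3 * s, k3:]"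
    by (simp add: pcompose_pCons m0_def m1_def algebra_simps power2_eq_square power3_eq_cube)
  then have shift: "rat_comp (to_fract [:k0, k1, k2, k3:]) (mob 1 s 0 1) = to_fract [:m0, m1, 0, k3:]"
    using rat_comp_affine[of 1 1 "[:k0, k1, k2, k3:]" s] by (simp add: to_fract_def s pcompose_1)
  have "transc (to_fract [:k0, k1, k2, k3:])"
    unfolding to_fract_def using assms by (intro transc_Fract) auto
  then have "eqv (to_fract [:k0, k1, k2, k3:]) (to_fract [:m0, m1, 0, k3:])"
    using eqv_right[of "to_fract [:k0, k1, k2, k3:]" "mob 1 s 0 1"] by (simp add: shift mobiusI)
  moreover from this have tr: "transc (to_fract [:m0, m1, 0, k3:])"
    by (rule eqv_transc)
  have "rat_comp (mob 1 (- m0) 0 k3) (to_fract [:m0, m1, 0, k3:]) =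
      rat_X ^ 3 + rat_const (m1 / k3) * rat_X"
    using assms tr
    by (subst rat_comp_mob) (auto simp: to_fract_pCons field_simps power3_eq_cube)
  then have "eqv (to_fract [:m0, m1, 0, k3:]) (rat_X ^ 3 + rat_const (m1 / k3) * rat_X)"
    using eqv_left[OF tr, of "mob 1 (- m0) 0 k3"] assms by (simp add: mobiusI)
  ultimately show thesis
    using that eqv_trans by blast
qed

text \<open>Substituting \<open>s x\<close> and dividing by \<open>s ^ 3\<close> divides the linear
  coefficient by \<open>s ^ 2\<close>; only its class modulo nonzero squares matters.\<close>

lemma eqv_cubic_scale:
  assumes "s \<noteq> 0"
  shows "eqv (rat_X ^ 3 - rat_const (c * s ^ 2) * rat_X) (rat_X ^ 3 - rat_const c * rat_X)"
proof -
  let ?R = "rat_X ^ 3 - rat_const (c * s ^ 2) * rat_X :: 'a poly fract"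
  have "?R = to_fract [:0, - c * s ^ 2, 0, 1:]"
    by (simp add: to_fract_pCons power3_eq_cube algebra_simps)
  moreover have "transc (to_fract [:0, - c * s ^ 2, 0, 1:])"
    unfolding to_fract_def by (intro transc_Fract) auto
  ultimately have tr: "transc ?R" by simp
  have M: "mob s 0 0 1 \<in> mobius" and B: "mob 1 0 0 (s ^ 3) \<in> mobius"
    using assms by (auto intro!: mobiusI)
  have "mob s 0 0 1 = rat_const s * rat_X"
    using assms rat_comp_mob[OF transc_X, of s 1 0 0] by simp
  then have *: "rat_comp ?R (mob s 0 0 1) =
      rat_const (s ^ 3) * (rat_X ^ 3 - rat_const c * rat_X)"
    using M by (simp add: algebra_simps power2_eq_square power3_eq_cube)
  have "transc (rat_comp ?R (mob s 0 0 1))"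
    by (intro transc_rat_comp transc_mobius M tr)
  then have "rat_comp (mob 1 0 0 (s ^ 3)) (rat_comp ?R (mob s 0 0 1)) =
      rat_comp ?R (mob s 0 0 1) / rat_const (s ^ 3)"
    using assms by (subst rat_comp_mob) simp_all
  then have "rat_comp (mob 1 0 0 (s ^ 3)) (rat_comp ?R (mob s 0 0 1)) =
      rat_X ^ 3 - rat_const c * rat_X"
    using assms unfolding * by simp
  then show ?thesis
    unfolding eqv_def using tr M B by metis
qed

text \<open>The hypotheses say that \<open>x = \<infinity>\<close> is a double zero of the Wronskian form.\<close>

lemma eqv_depressed_cubic_infinity:
  fixes g0 g1 g2 g3 h0 h1 h2 h3 :: "'a::field"
  defines "R \<equiv> to_fract [:g0, g1, g2, g3:] / to_fract [:h0, h1, h2, h3:]"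
  assumes R: "transc R" and "[:h0, h1, h2, h3:] \<noteq> 0" "(3::'a) \<noteq> 0" and "g3 \<noteq> 0 \<or> h3 \<noteq> 0"
    and p31: "g3 * h1 = g1 * h3" and p32: "g3 * h2 = g2 * h3"
  obtains e where "eqv R (rat_X ^ 3 + rat_const e * rat_X)"
proof (cases "h3 = 0")
  case True
  \<comment> \<open>Here the denominator is constant, so \<open>R\<close> is already a cubic
    polynomial.\<close>
  then have 0: "g3 \<noteq> 0" "h1 = 0" "h2 = 0" "h0 \<noteq> 0" using assms by auto
  have "R = to_fract [:g0 / h0, g1 / h0, g2 / h0, g3 / h0:]"
    using 0 True by (simp add: R_def to_fract_pCons field_simps)
  then show thesis
    using eqv_depressed_cubic[of "g3 / h0"] 0 assms(4) that by simp metis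
next
  case False
  \<comment> \<open>The vanishing minors make \<open>h3 g - g3 h\<close> equal to the constant
    \<kappa>. Hence \<open>h3 R - g3\<close> is \<kappa> divided by the denominator, and its
    reciprocal is a cubic polynomial.\<close>
  define \<kappa> where "\<kappa> = h3 * g0 - g3 * h0"
  define H where "H = to_fract [:h0, h1, h2, h3:]"
  have H: "H \<noteq> 0" using assms(3) unfolding H_def by (simp del: pCons_eq_0_iff)
  have "rat_const h3 * to_fract [:g0, g1, g2, g3:] - rat_const g3 * H = rat_const \<kappa>"
  proof -
    have "Polynomial.smult h3 [:g0, g1, g2, g3:] - Polynomial.smult g3 [:h0, h1, h2, h3:] = [:\<kappa>:]"
      using p31 p32 by (simp add: \<kappa>_def mult.commute)
    from arg_cong[OF this, of to_fract] show ?thesis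
      by (simp only: to_fract_diff to_fract_smult H_def rat_const_def)
  qed
  then have *: "rat_const h3 * R + rat_const (- g3) = rat_const \<kappa> / H"
    using H by (simp add: R_def field_simps flip: H_def)
  have "rat_const h3 * R + rat_const (- g3) \<noteq> 0"
    using False R by (intro transc_linear_nonzero) auto
  with * have \<kappa>: "\<kappa> \<noteq> 0" by auto
  have "rat_comp (mob 0 1 h3 (- g3)) R = H / rat_const \<kappa>"
    using False R by (subst rat_comp_mob) (auto simp: * simp del: rat_const.uminus)
  also have "\<dots> = to_fract [:h0 / \<kappa>, h1 / \<kappa>, h2 / \<kappa>, h3 / \<kappa>:]"
    using \<kappa> by (simp add: H_def to_fract_pCons field_simps)
  finally have "eqv R (to_fract [:h0 / \<kappa>, h1 / \<kappa>, h2 / \<kappa>, h3 / \<kappa>:])"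
    using eqv_left[OF R, of "mob 0 1 h3 (- g3)"] False by (simp add: mobiusI)
  moreover have nz: "h3 / \<kappa> \<noteq> 0" using False \<kappa> by simp
  obtain e where
    "eqv (to_fract [:h0 / \<kappa>, h1 / \<kappa>, h2 / \<kappa>, h3 / \<kappa>:]) (rat_X ^ 3 + rat_const e * rat_X)"
    by (rule eqv_depressed_cubic[OF nz assms(4)])
  ultimately show thesis using that eqv_trans by blast
qed

text \<open>Substituting \<open>1 / x\<close> reverses both coefficient lists and moves the double
  zero of the Wronskian from 0 to infinity.\<close>

lemma eqv_depressed_cubic_zero:
  fixes g0 g1 g2 g3 h0 h1 h2 h3 :: "'a::field"
  defines "R \<equiv> to_fract [:g0, g1, g2, g3:] / to_fract [:h0, h1, h2, h3:]"
  assumes R: "transc R" and "[:h0, h1, h2, h3:] \<noteq> 0" "(3::'a) \<noteq> 0" and "g0 \<noteq> 0 \<or> h0 \<noteq> 0"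
    and p10: "g1 * h0 = g0 * h1" and p20: "g2 * h0 = g0 * h2"
  obtains e where "eqv R (rat_X ^ 3 + rat_const e * rat_X)"
proof -
  define M :: "'a poly fract" where "M = mob 0 1 1 0"
  have M: "M \<in> mobius" by (simp add: M_def mobiusI)
  have M_eq: "M = 1 / rat_X"
    using rat_comp_mob[OF transc_X, of 0 0 1 1] by (simp add: M_def)
  have X: "rat_X \<noteq> (0 :: 'a poly fract)"
    by (simp add: rat_X_def)
  have *: "poly (map_poly rat_const [:k0, k1, k2, k3:]) M = to_fract [:k3, k2, k1, k0:] / rat_X ^ 3"
    for k0 k1 k2 k3
    unfolding M_eq using X by (simp add: to_fract_pCons field_simps power3_eq_cube)
  have "rat_comp R M = poly (map_poly rat_const [:g0, g1, g2, g3:]) M /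
      poly (map_poly rat_const [:h0, h1, h2, h3:]) M"
    unfolding R_def Fract_conv_to_fract[symmetric]
    by (rule rat_comp_Fract[OF transc_mobius[OF M] assms(3)])
  also have "\<dots> = to_fract [:g3, g2, g1, g0:] / to_fract [:h3, h2, h1, h0:]"
    unfolding * using X by simp
  finally have "eqv R (to_fract [:g3, g2, g1, g0:] / to_fract [:h3, h2, h1, h0:])"
    using eqv_right[OF R M] by simp
  moreover have "[:h3, h2, h1, h0:] \<noteq> 0" using assms(3) by auto
  then obtain e where
    "eqv (to_fract [:g3, g2, g1, g0:] / to_fract [:h3, h2, h1, h0:]) (rat_X ^ 3 + rat_const e * rat_X)"
    using eqv_depressed_cubic_infinity[OF eqv_transc[OF calculation] _ assms(4,5) p20[symmetric] p10[symmetric]]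
    by metis
  ultimately show thesis using that eqv_trans by blast
qed

text \<open>
  In the Pluecker coordinates \<open>p\<^sub>i\<^sub>j = g\<^sub>i h\<^sub>j - g\<^sub>j h\<^sub>i\<close>, a Wronskian
  \<open>k (x\<^sup>2 - \<sigma>)\<^sup>2\<close> and the relation \<open>p\<^sub>1\<^sub>0 p\<^sub>3\<^sub>2 - p\<^sub>2\<^sub>0 p\<^sub>3\<^sub>1 + p\<^sub>3\<^sub>0 p\<^sub>2\<^sub>1 = 0\<close> leave two
  possibilities: \<open>p\<^sub>3\<^sub>0 = k \<sigma> / 3\<close> is the desired one, and for \<open>p\<^sub>3\<^sub>0 = - k \<sigma>\<close> the
  factor \<open>x\<^sup>2 - \<sigma>\<close> divides both \<open>g\<close> and \<open>h\<close>.
\<close>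

lemma eqv_conjugate_triple_points:
  fixes \<sigma> g0 g1 g2 g3 h0 h1 h2 h3 :: "'a::field"
  defines "g \<equiv> [:g0, g1, g2, g3:]" and "h \<equiv> [:h0, h1, h2, h3:]"
  assumes "coprime g h" "h \<noteq> 0" "transc (to_fract g / to_fract h)" "(2::'a) \<noteq> 0" "(3::'a) \<noteq> 0"
    and "wronskian g h = Polynomial.smult k ([:- \<sigma>, 0, 1:] ^ 2)" "k \<noteq> 0"
  shows "eqv (to_fract g / to_fract h)
    ((rat_X ^ 3 + 3 * rat_const \<sigma> * rat_X) / (3 * rat_X ^ 2 + rat_const \<sigma>))"
proof -
  define p10 p20 p30 p21 p31 p32 where "p10 = g1 * h0 - g0 * h1" and "p20 = g2 * h0 - g0 * h2"
    and "p30 = g3 * h0 - g0 * h3" and "p21 = g2 * h1 - g1 * h2" and "p31 = g3 * h1 - g1 * h3"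
    and "p32 = g3 * h2 - g2 * h3"
  note p_defs = p10_def p20_def p30_def p21_def p31_def p32_def
  have "[:p10, 2 * p20, 3 * p30 + p21, 2 * p31, p32:] = Polynomial.smult k ([:- \<sigma>, 0, 1:] ^ 2)"
    using assms(8) unfolding g_def h_def wronskian_cubic p_defs .
  then have W: "p10 = k * \<sigma> ^ 2" "p20 = 0" "p31 = 0" "p32 = k" "p21 = - 2 * k * \<sigma> - 3 * p30"
    using assms(6) by (auto simp: power2_eq_square algebra_simps eq_neg_iff_add_eq_0)
  have "p10 * p32 - p20 * p31 + p30 * p21 = 0"
    by (simp add: p_defs algebra_simps)
  then have "(k * \<sigma> - 3 * p30) * (k * \<sigma> + p30) = 0"
    by (simp add: W algebra_simps power2_eq_square)
  then consider "3 * p30 = k * \<sigma>" | "p30 = - (k * \<sigma>)"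
    by (auto simp: eq_neg_iff_add_eq_0 add.commute)
  \<comment> \<open>The combinations in \<open>A\<close> and \<open>B\<close> eliminate the
    quadratic and the cubic term. In the first case they are \<open>k\<close> times the target
    numerator and \<open>- k / 3\<close> times the target denominator.\<close>
  moreover have A: "Polynomial.smult h2 g - Polynomial.smult g2 h = [:0, - p21, 0, k:]"
    using W by (simp add: g_def h_def p_defs algebra_simps)
  moreover have B: "Polynomial.smult h3 g - Polynomial.smult g3 h = [:- p30, 0, - k:]"
    using W by (simp add: g_def h_def p_defs algebra_simps)
  ultimately show ?thesis
  proof cases
    case 1
    define R where "R = to_fract g / to_fract h"
    have h: "to_fract h \<noteq> 0" using assms(4) by simp
    have A': "rat_const h2 * R + rat_const (- g2) = rat_const k * (rat_X ^ 3 + 3 * rat_const \<sigma> * rat_X) / to_fract h"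
    proof -
      have "rat_const h2 * R + rat_const (- g2) = to_fract (Polynomial.smult h2 g - Polynomial.smult g2 h) / to_fract h"
        using h by (simp add: R_def to_fract_smult field_simps)
      also have "- p21 = 3 * k * \<sigma>" using 1 W by (simp add: algebra_simps)
      then have "to_fract (Polynomial.smult h2 g - Polynomial.smult g2 h) =
          rat_const k * (rat_X ^ 3 + 3 * rat_const \<sigma> * rat_X)"
        unfolding A by (simp add: to_fract_pCons algebra_simps power3_eq_cube del: rat_const.uminus)
      finally show ?thesis .
    qed
    have B': "rat_const (- 3 * h3) * R + rat_const (3 * g3) =
        rat_const k * (3 * rat_X ^ 2 + rat_const \<sigma>) / to_fract h"
    proof -
      have "rat_const (- 3 * h3) * R + rat_const (3 * g3) =
          - 3 * to_fract (Polynomial.smult h3 g - Polynomial.smult g3 h) / to_fract h"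
        using h by (simp add: R_def to_fract_smult field_simps)
      also have "- 3 * to_fract (Polynomial.smult h3 g - Polynomial.smult g3 h) =
          rat_const (3 * p30) + rat_const k * (3 * rat_X ^ 2)"
        unfolding B by (simp add: to_fract_pCons algebra_simps power2_eq_square)
      also have "\<dots> = rat_const k * (3 * rat_X ^ 2 + rat_const \<sigma>)"
        unfolding 1 by (simp add: algebra_simps)
      finally show ?thesis .
    qed
    \<comment> \<open>The determinant is \<open>3 * p32 = 3 * k\<close>.\<close>
    have det: "h2 * (3 * g3) \<noteq> (- g2) * (- 3 * h3)"
      using W(4) assms by (auto simp: p32_def algebra_simps)
    have "rat_comp (mob h2 (- g2) (- 3 * h3) (3 * g3)) R =
        (rat_X ^ 3 + 3 * rat_const \<sigma> * rat_X) / (3 * rat_X ^ 2 + rat_const \<sigma>)"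
      using assms(5,9) h unfolding R_def[symmetric] rat_comp_mob[OF assms(5)[folded R_def] det] A' B' by simp
    then show ?thesis
      using eqv_left[OF assms(5), folded R_def, OF mobiusI[OF det]] by (simp flip: R_def)
  next
    case 2
    define m where "m = [:- \<sigma>, 0, 1:]"
    define U V where "U = Polynomial.smult h2 g - Polynomial.smult g2 h"
      and "V = Polynomial.smult h3 g - Polynomial.smult g3 h"
    have p21: "p21 = k * \<sigma>" using 2 W by (simp add: algebra_simps)
    have "U = m * [:0, k:]" "V = m * [:- k:]"
      unfolding U_def V_def A B m_def using 2 p21 by (simp_all add: algebra_simps)
    then have UV: "m dvd U" "m dvd V" by (metis dvd_triv_left)+
    \<comment> \<open>Solving back for \<open>g\<close> and \<open>h\<close> from \<open>U\<close>
      and \<open>V\<close> passes the common factor \<open>m\<close> on to them.\<close>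
    have "Polynomial.smult g2 V - Polynomial.smult g3 U = Polynomial.smult (- k) g"
      "Polynomial.smult h2 V - Polynomial.smult h3 U = Polynomial.smult (- k) h"
      unfolding U_def V_def W(4)[symmetric] p32_def
      by (simp_all add: smult_diff_right smult_diff_left mult.commute)
    then have "m dvd Polynomial.smult (- k) g" "m dvd Polynomial.smult (- k) h"
      using UV by (metis dvd_diff dvd_smult)+
    then have "m dvd g" "m dvd h" using assms(9) by (auto simp: dvd_smult_iff)
    then have "is_unit m" using assms(3) by (meson coprime_common_divisor)
    then show ?thesis by (simp add: m_def is_unit_iff_degree)
  qed
qed

section \<open>Few ramification points force a repeated factor over the ground field\<close>

text \<open>If the degree is four, there are at most three finite zeros; if it is three, infinity is
  ramified and leaves at most two. Either way a zero is repeated. Degree at most two means a double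
  zero at infinity.\<close>

lemma wronskian_double_zero:
  fixes R :: "'a::field poly fract"
  defines "W \<equiv> wronskian (rat_num R) (rat_den R)"
  assumes char: "CHAR('a) \<ge> 5" and deg: "rat_degree R = 3"
    and "finite (ramification_points R)" "card (ramification_points R) \<le> 3"
  shows "Polynomial.degree W \<le> 2 \<or>
    (\<exists>p. p ^ 2 dvd W \<and> (Polynomial.degree p = 1 \<or> Polynomial.degree p = 2) \<and>
      (\<forall>r s. p dvd r * s \<longrightarrow> p dvd r \<or> p dvd s))"
proof (cases "Polynomial.degree W \<le> 2")
  case False
  define g h where "g = rat_num R" and "h = rat_den R"
  have gh: "Polynomial.degree g \<le> 3" "Polynomial.degree h \<le> 3"
    using deg by (auto simp: rat_degree_def g_def h_def)
  note W = wronskian_cubic[of "Polynomial.coeff g 0" "Polynomial.coeff g 1" "Polynomial.coeff g 2"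
      "Polynomial.coeff g 3" "Polynomial.coeff h 0" "Polynomial.coeff h 1" "Polynomial.coeff h 2"
      "Polynomial.coeff h 3", folded cubic_conv_coeffs[OF gh(1)] cubic_conv_coeffs[OF gh(2)]]
  have deg4: "Polynomial.degree W \<le> 4"
    unfolding W_def g_def[symmetric] h_def[symmetric] W
    by (rule degree_le) (auto simp: coeff_pCons split: nat.splits)
  have coeff4: "Polynomial.coeff W 4 = Polynomial.coeff g 3 * Polynomial.coeff h 2
      - Polynomial.coeff g 2 * Polynomial.coeff h 3"
    unfolding W_def g_def[symmetric] h_def[symmetric] W
    by (simp add: numeral_eq_Suc)
  define Z where "Z = {x. poly (map_poly to_ac W) x = 0}"
  have W0: "W \<noteq> 0" using False by auto
  have Z: "Finite ` Z \<subseteq> ramification_points R"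
    using ramified_Finite[of R] deg by (auto simp: Z_def W_def)
  have "finite Z" using poly_roots_finite[of "map_poly to_ac W"] W0 by (simp add: Z_def)
  have card: "card (Finite ` Z) = card Z"
    by (rule card_image) (auto simp: inj_on_def)
  have "card Z < Polynomial.degree W"
  proof (cases "Polynomial.degree W = 4")
    case True
    then show ?thesis using card_mono[OF assms(4) Z] card assms(5) by simp
  next
    case deg3: False
    then have "Polynomial.degree W = 3" using deg4 False by linarith
    then have "Polynomial.coeff W 4 = 0" by (simp add: coeff_eq_0)
    \<comment> \<open>The vanishing coefficient of degree four is the condition of
      \<open>ramified_Infinity\<close> for \<open>n = 1\<close>.\<close>
    then have "Infinity \<in> ramification_points R"
      using ramified_Infinity[of R 1] deg coeff4
      by (simp add: g_def h_def numeral_2_eq_2 numeral_3_eq_3)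
    then have "card (insert Infinity (Finite ` Z)) \<le> 3"
      using card_mono[OF assms(4), of "insert Infinity (Finite ` Z)"] Z assms(5) by simp
    moreover have "card (insert Infinity (Finite ` Z)) = Suc (card Z)"
      using \<open>finite Z\<close> card by (subst card_insert_disjoint) auto
    ultimately show ?thesis using \<open>Polynomial.degree W = 3\<close> by simp
  qed
  then obtain \<alpha> where \<alpha>: "poly (map_poly to_ac W) \<alpha> = 0" "poly (pderiv (map_poly to_ac W)) \<alpha> = 0"
    using double_root_of_few_roots[of "map_poly to_ac W"] W0 unfolding Z_def by auto
  have "Polynomial.degree W < CHAR('a)" using deg4 char by linarith
  then obtain p where p: "p ^ 2 dvd W" "Polynomial.degree p > 0"
    "\<And>r. poly (map_poly to_ac r) \<alpha> = 0 \<longleftrightarrow> p dvd r"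
    using minimal_poly_factor[OF to_ac.field_embedding_axioms W0 \<alpha>] by metis
  have "p \<noteq> 0" using p(2) by auto
  have "Polynomial.degree (p ^ 2) \<le> 4"
    using dvd_imp_degree_le[OF p(1) W0] deg4 by linarith
  then have "Polynomial.degree p = 1 \<or> Polynomial.degree p = 2"
    using p(2) \<open>p \<noteq> 0\<close> by (simp add: degree_power_eq) linarith
  \<comment> \<open>Divisibility by \<open>p\<close> means vanishing at \<alpha>, so
    \<open>p\<close> is prime because values lie in a field.\<close>
  moreover have "p dvd r \<or> p dvd s" if "p dvd r * s" for r s
    using that by (simp flip: p(3))
  ultimately show ?thesis using p(1) by blast
qed simp

section \<open>Normal form of a coprime cubic pair from the position of the double zero\<close>

context
  fixes g h :: "'a::field poly"
  assumes gh: "coprime g h" "h \<noteq> 0" "max (Polynomial.degree g) (Polynomial.degree h) = 3"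
    and char: "CHAR('a) \<ge> 5"
begin

lemma three_ne_0: "(3 :: 'a) \<noteq> 0"
  using of_nat_eq_0_iff_char_dvd[where ?'a = 'a, of 3] char by (auto dest: dvd_imp_le)

lemma two_ne_0: "(2 :: 'a) \<noteq> 0"
  using of_nat_eq_0_iff_char_dvd[where ?'a = 'a, of 2] char by (auto dest: dvd_imp_le)

lemma transc_cubic: "transc (Fraction_Field.Fract g h)"
  using gh by (intro transc_Fract) auto

text \<open>The new pair again satisfies the assumptions on \<open>g\<close> and \<open>h\<close>,
  so a factor of the Wronskian can first be moved to a standard position.\<close>

lemma affine_change:
  fixes b t :: 'a
  assumes "t \<noteq> 0"
  defines "g' \<equiv> pcompose g [:b, t:]" and "h' \<equiv> pcompose h [:b, t:]"
  shows "coprime g' h'" "h' \<noteq> 0" "max (Polynomial.degree g') (Polynomial.degree h') = 3"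
    and "eqv (Fraction_Field.Fract g h) (Fraction_Field.Fract g' h')"
    and "p ^ n dvd wronskian g h \<Longrightarrow> pcompose p [:b, t:] ^ n dvd wronskian g' h'"
proof -
  show "coprime g' h'" unfolding g'_def h'_def using gh(1) by (rule coprime_pcompose)
  show "h' \<noteq> 0" using gh(2) assms(1) by (simp add: h'_def pcompose_eq_0_iff)
  show "max (Polynomial.degree g') (Polynomial.degree h') = 3"
    using gh(3) assms(1) by (simp add: g'_def h'_def degree_pcompose)
  show "eqv (Fraction_Field.Fract g h) (Fraction_Field.Fract g' h')"
    using eqv_right[OF transc_cubic, of "mob t b 0 1"] rat_comp_affine[OF gh(2) assms(1), of g b] assms(1)
    by (simp add: g'_def h'_def mobiusI)
  show "pcompose p [:b, t:] ^ n dvd wronskian g' h'" if dvd: "p ^ n dvd wronskian g h"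
  proof -
    from dvd obtain q where "wronskian g h = p ^ n * q" by (auto elim: dvdE)
    moreover have "pcompose (p ^ n) [:b, t:] = pcompose p [:b, t:] ^ n"
      by (induction n) (simp_all add: pcompose_mult pcompose_1)
    ultimately show ?thesis
      by (simp add: g'_def h'_def wronskian_pcompose pcompose_mult)
  qed
qed

lemma coeffs_cubic:
  obtains g0 g1 g2 g3 h0 h1 h2 h3 where "g = [:g0, g1, g2, g3:]" "h = [:h0, h1, h2, h3:]" "g3 \<noteq> 0 \<or> h3 \<noteq> 0"
proof -
  have le: "Polynomial.degree g \<le> 3" "Polynomial.degree h \<le> 3"
    using gh(3) by auto
  have "Polynomial.coeff g 3 \<noteq> 0 \<or> Polynomial.coeff h 3 \<noteq> 0"
  proof (cases "Polynomial.degree g = 3")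
    case True
    then show ?thesis by (metis leading_coeff_0_iff degree_0 zero_neq_numeral)
  next
    case False
    then have "Polynomial.degree h = 3" using gh(3) by (auto simp: max_def split: if_splits)
    then show ?thesis by (metis leading_coeff_0_iff degree_0 zero_neq_numeral)
  qed
  then show thesis
    by (rule that[OF cubic_conv_coeffs[OF le(1)] cubic_conv_coeffs[OF le(2)]])
qed

lemma eqv_depressed_cubic_of_degree:
  assumes "Polynomial.degree (wronskian g h) \<le> 2"
  obtains e where "eqv (Fraction_Field.Fract g h) (rat_X ^ 3 + rat_const e * rat_X)"
proof -
  obtain g0 g1 g2 g3 h0 h1 h2 h3 where c: "g = [:g0, g1, g2, g3:]" "h = [:h0, h1, h2, h3:]" "g3 \<noteq> 0 \<or> h3 \<noteq> 0"
    by (rule coeffs_cubic)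
  have "Polynomial.coeff (wronskian g h) 3 = 0" "Polynomial.coeff (wronskian g h) 4 = 0"
    using assms by (auto intro!: coeff_eq_0)
  then have "g3 * h1 = g1 * h3" "g3 * h2 = g2 * h3"
    using two_ne_0 by (simp_all add: c(1,2) wronskian_cubic numeral_eq_Suc)
  then show thesis
    using eqv_depressed_cubic_infinity[of g0 g1 g2 g3 h0 h1 h2 h3] that transc_cubic gh(2) three_ne_0 c(3)
    unfolding c(1,2) Fract_conv_to_fract by metis
qed

lemma eqv_depressed_cubic_of_X_dvd:
  assumes "[:0, 1:] ^ 2 dvd wronskian g h"
  obtains e where "eqv (Fraction_Field.Fract g h) (rat_X ^ 3 + rat_const e * rat_X)"
proof -
  obtain g0 g1 g2 g3 h0 h1 h2 h3 where c: "g = [:g0, g1, g2, g3:]" "h = [:h0, h1, h2, h3:]"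
    by (rule coeffs_cubic)
  from assms obtain q where "wronskian g h = [:0, 1:] ^ 2 * q" by (auto elim: dvdE)
  then have "wronskian g h = pCons 0 (pCons 0 q)" by (simp add: power2_eq_square)
  then have "g1 * h0 = g0 * h1" "g2 * h0 = g0 * h2"
    using two_ne_0 by (simp_all add: c wronskian_cubic)
  \<comment> \<open>If both constant terms vanished, \<open>x\<close> would be a common
    factor.\<close>
  moreover have "g0 \<noteq> 0 \<or> h0 \<noteq> 0"
  proof (rule ccontr)
    assume "\<not> ?thesis"
    then have "[:0, 1:] dvd g" "[:0, 1:] dvd h"
      unfolding c by (simp_all add: dvd_iff_poly_eq_0)
    then have "is_unit ([:0, 1:] :: 'a poly)"
      using gh(1) by (meson coprime_common_divisor)
    then show False by (simp add: is_unit_iff_degree)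
  qed
  ultimately show thesis
    using eqv_depressed_cubic_zero[of g0 g1 g2 g3 h0 h1 h2 h3] that transc_cubic gh(2) three_ne_0
    unfolding c Fract_conv_to_fract by metis
qed

text \<open>The Wronskian is nonzero of degree at most four, so the cofactor of the square is a
  nonzero constant.\<close>

lemma eqv_conjugate_of_dvd:
  assumes "[:- \<sigma>, 0, 1:] ^ 2 dvd wronskian g h"
  shows "eqv (Fraction_Field.Fract g h)
    ((rat_X ^ 3 + 3 * rat_const \<sigma> * rat_X) / (3 * rat_X ^ 2 + rat_const \<sigma>))"
proof -
  obtain g0 g1 g2 g3 h0 h1 h2 h3 where c: "g = [:g0, g1, g2, g3:]" "h = [:h0, h1, h2, h3:]"
    by (rule coeffs_cubic)
  from assms obtain q where q: "wronskian g h = [:- \<sigma>, 0, 1:] ^ 2 * q" by (auto elim: dvdE)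
  have W0: "wronskian g h \<noteq> 0"
    using gh(3) char by (intro wronskian_nonzero gh(1)) auto
  then have "q \<noteq> 0" using q by auto
  have "Polynomial.degree (wronskian g h) \<le> 4"
    unfolding c wronskian_cubic by (rule degree_le) (auto simp: coeff_pCons split: nat.splits)
  then have "Polynomial.degree q = 0"
    using \<open>q \<noteq> 0\<close> unfolding q by (subst (asm) degree_mult_eq) (auto simp: degree_power_eq)
  then obtain k where "q = [:k:]" by (rule degree_eq_zeroE)
  then have "wronskian g h = Polynomial.smult k ([:- \<sigma>, 0, 1:] ^ 2)" "k \<noteq> 0"
    using q \<open>q \<noteq> 0\<close> by simp_all
  then show ?thesis
    using eqv_conjugate_triple_points[of g0 g1 g2 g3 h0 h1 h2 h3 k \<sigma>] gh transc_cubic two_ne_0 three_ne_0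
    unfolding c Fract_conv_to_fract by blast
qed

end

theorem theorem5p3:
  fixes \<sigma> :: "'a::{field, finite}" and R :: "'a poly fract"
  assumes "CHAR('a) \<ge> 5"
    and "\<not> (\<exists>y. \<sigma> = y ^ 2)"
    and "rat_degree R = 3"
    and "finite (ramification_points R)" and "card (ramification_points R) \<le> 3"
  shows "rat_equivalent R (rat_X ^ 3) \<or>
         rat_equivalent R ((rat_X ^ 3 + 3 * rat_const \<sigma> * rat_X) / (3 * rat_X ^ 2 + rat_const \<sigma>)) \<or>
         rat_equivalent R (rat_X ^ 3 - 3 * rat_X) \<or>
         rat_equivalent R (rat_X ^ 3 - 3 * rat_const \<sigma> * rat_X)"
proof -
  define g h where "g = rat_num R" and "h = rat_den R"
  define T where "T = (rat_X ^ 3 + 3 * rat_const \<sigma> * rat_X) / (3 * rat_X ^ 2 + rat_const \<sigma>)"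
  have gh: "coprime g h" "h \<noteq> 0" "max (Polynomial.degree g) (Polynomial.degree h) = 3"
    and R: "R = Fraction_Field.Fract g h"
    using rat_num_den[of R] assms(3) by (simp_all add: g_def h_def rat_degree_def)
  have two: "(2 :: 'a) \<noteq> 0" and three: "(3 :: 'a) \<noteq> 0"
    using two_ne_0 three_ne_0 gh assms(1) by blast+
  consider "Polynomial.degree (wronskian g h) \<le> 2"
    | p where "p ^ 2 dvd wronskian g h" "Polynomial.degree p = 1 \<or> Polynomial.degree p = 2"
      "\<forall>r s. p dvd r * s \<longrightarrow> p dvd r \<or> p dvd s"
    using wronskian_double_zero[OF assms(1,3,4,5), folded g_def h_def] by blast
  then have "(\<exists>e. eqv R (rat_X ^ 3 + rat_const e * rat_X)) \<or> eqv R T"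
  proof cases
    case 1
    then obtain e where "eqv R (rat_X ^ 3 + rat_const e * rat_X)"
      unfolding R by (rule eqv_depressed_cubic_of_degree[OF gh assms(1)])
    then show ?thesis by blast
  next
    case (2 p)
    from 2(2) show ?thesis
    proof
      assume deg: "Polynomial.degree p = 1"
      define a b where "a = Polynomial.coeff p 1" and "b = Polynomial.coeff p 0"
      have p: "p = [:b, a:]"
        using cubic_conv_coeffs[of p] deg by (simp add: a_def b_def coeff_eq_0)
      have a: "a \<noteq> 0"
        using deg unfolding a_def by (metis degree_0 leading_coeff_0_iff zero_neq_one)
      \<comment> \<open>Translation by the root \<open>- b / a\<close> of \<open>p\<close> moves
        that root to 0.\<close>
      note change = affine_change[OF gh assms(1) one_neq_zero, where b = "- b / a"]
      have "pcompose p [:- b / a, 1:] = [:a:] * [:0, 1:]"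
        using a by (simp add: p pcompose_pCons)
      then have "[:0, 1:] dvd pcompose p [:- b / a, 1:]" by (metis dvd_triv_right)
      then have "[:0, 1:] ^ 2 dvd wronskian (pcompose g [:- b / a, 1:]) (pcompose h [:- b / a, 1:])"
        using change(5)[OF 2(1)] by (rule dvd_trans[OF dvd_power_same])
      then obtain e where "eqv (Fraction_Field.Fract (pcompose g [:- b / a, 1:])
          (pcompose h [:- b / a, 1:])) (rat_X ^ 3 + rat_const e * rat_X)"
        by (rule eqv_depressed_cubic_of_X_dvd[OF change(1,2,3) assms(1)])
      then show ?thesis
        using eqv_trans[OF change(4)] unfolding R by blast
    next
      assume deg: "Polynomial.degree p = 2"
      define c0 c1 c2 where "c0 = Polynomial.coeff p 0" and "c1 = Polynomial.coeff p 1"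
        and "c2 = Polynomial.coeff p 2"
      have p: "p = [:c0, c1, c2:]"
        using cubic_conv_coeffs[of p] deg by (simp add: c0_def c1_def c2_def coeff_eq_0)
      have c2: "c2 \<noteq> 0" using deg p by (cases "c2 = 0") (auto split: if_splits)
      \<comment> \<open>Completing the square: \<open>p = c2 ((x - b) ^ 2 - c)\<close>.\<close>
      define b where "b = - c1 / (2 * c2)"
      define c where "c = b ^ 2 - c0 / c2"
      have c1: "c1 = - 2 * b * c2" and c0: "c0 = c2 * (b ^ 2 - c)"
        using c2 two by (simp_all add: b_def c_def)
      \<comment> \<open>A square \<open>c\<close> would split \<open>p\<close> into linear factors,
        contradicting primality.\<close>
      have "\<nexists>y. c = y ^ 2"
      proof
        assume "\<exists>y. c = y ^ 2"
        then obtain y where y: "c = y ^ 2" by blast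
        have "p = [:c2:] * ([:- b - y, 1:] * [:- b + y, 1:])"
          by (simp add: p c0 c1 y algebra_simps power2_eq_square)
        then have "p dvd [:c2:] * ([:- b - y, 1:] * [:- b + y, 1:])" by simp
        then have "p dvd [:c2:] \<or> p dvd [:- b - y, 1:] \<or> p dvd [:- b + y, 1:]"
          using 2(3) by blast
        then show False
          using deg c2 by (auto dest!: dvd_imp_degree_le)
      qed
      then obtain t where t: "c = \<sigma> * t ^ 2" "t \<noteq> 0"
        using nonsquare_ratio assms(2) by metis
      \<comment> \<open>Substituting \<open>t x + b\<close> turns \<open>(x - b) ^ 2 - c\<close>
        into \<open>t ^ 2 (x ^ 2 - \<sigma>)\<close>.\<close>
      note change = affine_change[OF gh assms(1) t(2), where b = b]
      have "pcompose p [:b, t:] = [:c2 * t ^ 2:] * [:- \<sigma>, 0, 1:]"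
        by (simp add: p c0 c1 t pcompose_pCons algebra_simps power2_eq_square)
      then have "[:- \<sigma>, 0, 1:] dvd pcompose p [:b, t:]" by (metis dvd_triv_right)
      then have "[:- \<sigma>, 0, 1:] ^ 2 dvd wronskian (pcompose g [:b, t:]) (pcompose h [:b, t:])"
        using change(5)[OF 2(1)] by (rule dvd_trans[OF dvd_power_same])
      then have "eqv (Fraction_Field.Fract (pcompose g [:b, t:]) (pcompose h [:b, t:])) T"
        unfolding T_def by (rule eqv_conjugate_of_dvd[OF change(1,2,3) assms(1)])
      then show ?thesis
        using eqv_trans[OF change(4)] unfolding R by blast
    qed
  qed
  then show ?thesis
  proof
    assume "\<exists>e. eqv R (rat_X ^ 3 + rat_const e * rat_X)"
    then obtain e where e: "eqv R (rat_X ^ 3 + rat_const e * rat_X)" by blast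
    \<comment> \<open>Writing the cubic as \<open>x ^ 3 - 3 c x\<close>, the cases of
      \<open>c\<close> zero, a nonzero square or a nonsquare give the three polynomial
      forms.\<close>
    define c where "c = - e / 3"
    have e_eq: "e = - 3 * c" using three by (simp add: c_def)
    consider "c = 0" | s where "s \<noteq> 0" "c = s ^ 2" | "\<nexists>s. c = s ^ 2"
      by (metis zero_power2)
    then show ?thesis
    proof cases
      case 1
      then show ?thesis using e eqv_imp_rat_equivalent by (auto simp: e_eq)
    next
      case (2 s)
      then have "rat_X ^ 3 + rat_const e * rat_X = rat_X ^ 3 - rat_const (3 * s ^ 2) * rat_X"
        by (simp add: e_eq)
      then have "eqv R (rat_X ^ 3 - rat_const 3 * rat_X)"
        using e eqv_cubic_scale[OF 2(1)] eqv_trans by metis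
      then show ?thesis using eqv_imp_rat_equivalent by auto
    next
      case 3
      then obtain s where s: "c = \<sigma> * s ^ 2" "s \<noteq> 0"
        using nonsquare_ratio assms(2) by metis
      then have "rat_X ^ 3 + rat_const e * rat_X = rat_X ^ 3 - rat_const (3 * \<sigma> * s ^ 2) * rat_X"
        by (simp add: e_eq)
      then have "eqv R (rat_X ^ 3 - rat_const (3 * \<sigma>) * rat_X)"
        using e eqv_cubic_scale[OF s(2)] eqv_trans by metis
      then show ?thesis using eqv_imp_rat_equivalent by auto
    qed
  qed (use eqv_imp_rat_equivalent T_def in blast)
qed

end
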